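(* For every $v\in(0,1)$, the quotient between the maximum value of the Gauss curvature and the minimum value of the Gauss curvature of the special Twizzler $\mathbb{S}\mathfrak{T}(v)=\mathfrak{T}(0,v)$ is $-v$. Moreover, $\mathbb{S}\mathfrak{T}(v)$ is isometric to the unduloid $\mathbb{D}\big(-\frac{\sqrt v}{(1+\sqrt v)^2}\big)$ and to the nodoid $\mathbb{D}\big(\frac{\sqrt v}{(1-\sqrt v)^2}\big)$.
   Context: Twizzlers: a Twizzler is an immersion $\phi(s,t)=(x(s)\cos(wt)+z(s)\sin(wt),\,t,\,-x(s)\sin(wt)+z(s)\cos(wt))$, $(s,t)\in\mathbb{R}^2$, of constant mean curvature; $\alpha(s)=(x(s),z(s))$, $s\in\mathbb{R}$, parametrized by arc length, is its profile curve. The mean curvature (half the sum of the principal curvatures) is taken with respect to $\nu=\frac{\phi_s\times\phi_t}{|\phi_s\times\phi_t|}$. Put $\xi_1=xx'+zz'$, $\xi_2=-xz'+zx'$. $\mathfrak{T}(M,v)$, for $M>-\frac14$ and $0<v<1$, denotes the Twizzler (unique up to rigid motions) with mean curvature $1$ and parameter $w=\sqrt{(1-v)/v}$ for which $s\mapsto(\xi_1(s),\xi_2(s))$ traverses the closed curve $h_w^{-1}(M)$, where $h_w(x_1,x_2)=x_1^2+x_2^2+\frac{x_2}{\sqrt{1+w^2x_1^2}}$; that is, $h_w(\xi_1(s),\xi_2(s))=M$ for all $s$. The special Twizzlers are those with $M=0$; they contain the axis of symmetry. For nonzero $M\in(-\frac14,\infty)$, $\mathbb{D}(M)$ is the Delaunay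 surface with mean curvature $1$ obtained by rolling the conic $\{(x,y):4x^2-\frac{y^2}{M}=1\}$ without slipping on a line in a plane and rotating about this line the trace of a focus. For $M<0$ (ellipse; one focus used) it is an unduloid. For $M>0$ (hyperbola) both foci are used: as a branch of the hyperbola rolls on the line, the two foci trace two arcs, one on each side of the line; after reflecting one of them in the line and translating along the line, copies of the two arcs alternately fit together into a complete $C^2$ (in fact smooth) periodic profile curve; rotating it about the line gives the nodoid $\mathbb{D}(M)$. "Isometric" means that the Riemannian universal covers of the immersed surfaces, with the induced metrics, are isometric (for a Twizzler this is $\mathbb{R}^2$ with the metric induced by $\phi$). *)

theory Defs
  imports "HOL-Analysis.Analysis"
begin


section \<open>Smooth maps\<close>

text \<open>On a finite-dimensional domain, \<open>Ck (Suc k) f\<close> (all directional derivatives are of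
  class \<open>C\<^sup>k\<close>) is the usual notion of a \<open>C\<close>-\<open>(k+1)\<close> map, since the derivative is determined
  by finitely many directional derivatives.\<close>

primrec Ck :: "nat \<Rightarrow> ('a::real_normed_vector \<Rightarrow> 'b::real_normed_vector) \<Rightarrow> bool" where
  "Ck 0 = (\<lambda>f. continuous_on UNIV f)"
| "Ck (Suc k) = (\<lambda>f. (\<forall>x. f differentiable (at x)) \<and>
                      (\<forall>h. Ck k (\<lambda>x. frechet_derivative f (at x) h)))"

definition smooth :: "('a::real_normed_vector \<Rightarrow> 'b::real_normed_vector) \<Rightarrow> bool" where
  "smooth f \<longleftrightarrow> (\<forall>k. Ck k f)"

section \<open>Immersed planes in three-space\<close>

definition immersion :: "(real \<times> real \<Rightarrow> real ^ 3) \<Rightarrow> bool" where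
  "immersion f \<longleftrightarrow> smooth f \<and> (\<forall>p. inj (frechet_derivative f (at p)))"

definition induced_metric ::
  "(real \<times> real \<Rightarrow> real ^ 3) \<Rightarrow> real \<times> real \<Rightarrow> real \<times> real \<Rightarrow> real \<times> real \<Rightarrow> real" where
  "induced_metric f p a b = frechet_derivative f (at p) a \<bullet> frechet_derivative f (at p) b"

definition coord_vec :: "2 \<Rightarrow> real \<times> real" where
  "coord_vec i = (if i = 1 then (1, 0) else (0, 1))"

definition pd :: "2 \<Rightarrow> (real \<times> real \<Rightarrow> real ^ 3) \<Rightarrow> real \<times> real \<Rightarrow> real ^ 3" where
  "pd i f p = frechet_derivative f (at p) (coord_vec i)"

definition unit_normal :: "(real \<times> real \<Rightarrow> real ^ 3) \<Rightarrow> real \<times> real \<Rightarrow> real ^ 3" where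
  "unit_normal f p = sgn (cross3 (pd 1 f p) (pd 2 f p))"

definition first_form :: "(real \<times> real \<Rightarrow> real ^ 3) \<Rightarrow> real \<times> real \<Rightarrow> real ^ 2 ^ 2" where
  "first_form f p = (\<chi> i j. pd i f p \<bullet> pd j f p)"

definition second_form :: "(real \<times> real \<Rightarrow> real ^ 3) \<Rightarrow> real \<times> real \<Rightarrow> real ^ 2 ^ 2" where
  "second_form f p = (\<chi> i j. pd i (pd j f) p \<bullet> unit_normal f p)"

text \<open>Matrix of \<open>- d\<nu>\<close> in the coordinate basis; its eigenvalues are the principal curvatures,
  so their half sum and their product are half the trace and the determinant.\<close>

definition shape_operator :: "(real \<times> real \<Rightarrow> real ^ 3) \<Rightarrow> real \<times> real \<Rightarrow> real ^ 2 ^ 2" where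
  "shape_operator f p = matrix_inv (first_form f p) ** second_form f p"

definition mean_curvature :: "(real \<times> real \<Rightarrow> real ^ 3) \<Rightarrow> real \<times> real \<Rightarrow> real" where
  "mean_curvature f p = trace (shape_operator f p) / 2"

definition gauss_curvature :: "(real \<times> real \<Rightarrow> real ^ 3) \<Rightarrow> real \<times> real \<Rightarrow> real" where
  "gauss_curvature f p = det (shape_operator f p)"

text \<open>Every surface below is given as an immersion of the plane, precomposed with the universal
  covering where the surface itself is not simply connected (for a surface of revolution whose
  profile curve misses the axis, the second coordinate is the unrolled angle).  So this is
  isometry of the Riemannian universal covers.\<close>

definition isometric_planes ::
  "(real \<times> real \<Rightarrow> real ^ 3) \<Rightarrow> (real \<times> real \<Rightarrow> real ^ 3) \<Rightarrow> bool" where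
  "isometric_planes f g \<longleftrightarrow>
     (\<exists>\<Phi> :: real \<times> real \<Rightarrow> real \<times> real.
        bij \<Phi> \<and> smooth \<Phi> \<and> smooth (inv \<Phi>) \<and>
        (\<forall>p a b. induced_metric f p a b =
                 induced_metric g (\<Phi> p) (frechet_derivative \<Phi> (at p) a)
                                        (frechet_derivative \<Phi> (at p) b)))"

section \<open>Twizzlers\<close>

definition twizzler_map ::
  "real \<Rightarrow> (real \<Rightarrow> real) \<Rightarrow> (real \<Rightarrow> real) \<Rightarrow> real \<times> real \<Rightarrow> real ^ 3" where
  "twizzler_map w x z = (\<lambda>(s, t).
     vector [x s * cos (w * t) + z s * sin (w * t),
             t,
             - x s * sin (w * t) + z s * cos (w * t)])"

definition xi1 :: "(real \<Rightarrow> real) \<Rightarrow> (real \<Rightarrow> real) \<Rightarrow> real \<Rightarrow> real" where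
  "xi1 x z s = x s * deriv x s + z s * deriv z s"

definition xi2 :: "(real \<Rightarrow> real) \<Rightarrow> (real \<Rightarrow> real) \<Rightarrow> real \<Rightarrow> real" where
  "xi2 x z s = - x s * deriv z s + z s * deriv x s"

definition h_fun :: "real \<Rightarrow> real \<Rightarrow> real \<Rightarrow> real" where
  "h_fun w x1 x2 = x1\<^sup>2 + x2\<^sup>2 + x2 / sqrt (1 + w\<^sup>2 * x1\<^sup>2)"

definition pitch :: "real \<Rightarrow> real" where
  "pitch v = sqrt ((1 - v) / v)"

definition twizzler_profile :: "real \<Rightarrow> real \<Rightarrow> (real \<Rightarrow> real) \<Rightarrow> (real \<Rightarrow> real) \<Rightarrow> bool" where
  "twizzler_profile M v x z \<longleftrightarrow>
     - 1 / 4 < M \<and> 0 < v \<and> v < 1 \<and>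
     smooth x \<and> smooth z \<and> (\<forall>s. (deriv x s)\<^sup>2 + (deriv z s)\<^sup>2 = 1) \<and>
     immersion (twizzler_map (pitch v) x z) \<and>
     (\<forall>p. mean_curvature (twizzler_map (pitch v) x z) p = 1) \<and>
     (\<forall>s. h_fun (pitch v) (xi1 x z s) (xi2 x z s) = M)"

text \<open>The Twizzler of mean curvature 1 with parameters \<open>M\<close> and \<open>v\<close> is determined only up to
  rigid motions (and the choice of the base point of the profile curve), hence a predicate.\<close>

definition twizzler :: "real \<Rightarrow> real \<Rightarrow> (real \<times> real \<Rightarrow> real ^ 3) \<Rightarrow> bool" where
  "twizzler M v S \<longleftrightarrow> (\<exists>x z. twizzler_profile M v x z \<and> S = twizzler_map (pitch v) x z)"

definition special_twizzler :: "real \<Rightarrow> (real \<times> real \<Rightarrow> real ^ 3) \<Rightarrow> bool" where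
  "special_twizzler v S \<longleftrightarrow> twizzler 0 v S"

section \<open>Rolling curves and Delaunay surfaces\<close>

text \<open>The plane is \<^typ>\<open>complex\<close>, the line is the real axis.\<close>

definition arclen :: "(real \<Rightarrow> complex) \<Rightarrow> real \<Rightarrow> real" where
  "arclen \<gamma> u = (LBINT \<tau>=0..u. norm (vector_derivative \<gamma> (at \<tau>)))"

text \<open>Position of the point \<open>q\<close>, rigidly attached to the regular curve \<open>\<gamma>\<close>, at the moment when
  the rolling curve touches the line with its point \<open>\<gamma> u\<close>: the orientation-preserving motion
  sends \<open>\<gamma> u\<close> to \<open>arclen \<gamma> u\<close> (no slipping) and the unit tangent of \<open>\<gamma>\<close> at \<open>u\<close> to 1.\<close>

definition roll :: "(real \<Rightarrow> complex) \<Rightarrow> complex \<Rightarrow> real \<Rightarrow> complex" where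
  "roll \<gamma> q u = of_real (arclen \<gamma> u) + (q - \<gamma> u) * cnj (sgn (vector_derivative \<gamma> (at u)))"

definition conic_curve :: "real \<Rightarrow> complex set" where
  "conic_curve M = {p. 4 * (Re p)\<^sup>2 - (Im p)\<^sup>2 / M = 1}"

text \<open>Half the focal distance of \<^term>\<open>conic_curve M\<close>; the foci are \<open>\<plusminus> focal M\<close> for both
  signs of \<open>M\<close> because \<open>M > - 1/4\<close>.\<close>

definition focal :: "real \<Rightarrow> real" where
  "focal M = sqrt (1 / 4 + M)"

definition ellipse :: "real \<Rightarrow> real \<Rightarrow> complex" where
  "ellipse M u = Complex (cos u / 2) (sqrt (- M) * sin u)"

definition hyperbola_branch :: "real \<Rightarrow> real \<Rightarrow> complex" where
  "hyperbola_branch M u = Complex (cosh u / 2) (sqrt M * sinh u)"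

lemma range_ellipse:
  assumes "M < 0"
  shows "range (ellipse M) = conic_curve M"
proof (intro equalityI subsetI)
  fix p assume "p \<in> range (ellipse M)"
  then obtain u where "p = ellipse M u" by auto
  moreover have "(sqrt (- M) * sin u)\<^sup>2 / M = - (sin u)\<^sup>2"
    using assms by (simp add: power_mult_distrib)
  moreover have "(cos u)\<^sup>2 + (sin u)\<^sup>2 = 1" by simp
  ultimately show "p \<in> conic_curve M"
    by (simp add: conic_curve_def ellipse_def power_divide)
next
  fix p assume p: "p \<in> conic_curve M"
  have "(2 * Re p)\<^sup>2 + (Im p / sqrt (- M))\<^sup>2 = 1"
    using p assms by (simp add: conic_curve_def power_mult_distrib power_divide)
  then obtain u where "2 * Re p = cos u" "Im p / sqrt (- M) = sin u"
    using sincos_total_2pi by metis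
  then have "p = ellipse M u"
    using assms by (simp add: ellipse_def complex_eq_iff field_simps)
  then show "p \<in> range (ellipse M)" by auto
qed

lemma range_hyperbola_branch:
  assumes "M > 0"
  shows "range (hyperbola_branch M) = {p \<in> conic_curve M. Re p > 0}"
proof (intro equalityI subsetI)
  fix p assume "p \<in> range (hyperbola_branch M)"
  then obtain u where "p = hyperbola_branch M u" by auto
  moreover have "(sqrt M * sinh u)\<^sup>2 / M = (sinh u)\<^sup>2"
    using assms by (simp add: power_mult_distrib)
  moreover have "(cosh u)\<^sup>2 - (sinh u)\<^sup>2 = 1" by (simp add: cosh_square_eq)
  ultimately show "p \<in> {p \<in> conic_curve M. Re p > 0}"
    by (simp add: conic_curve_def hyperbola_branch_def power_divide)
next
  fix p assume p: "p \<in> {p \<in> conic_curve M. Re p > 0}"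
  define u where "u = arsinh (Im p / sqrt M)"
  have s: "sinh u = Im p / sqrt M" by (simp add: u_def)
  have "(2 * Re p)\<^sup>2 = (cosh u)\<^sup>2"
    using p assms by (simp add: conic_curve_def s cosh_square_eq power_mult_distrib power_divide)
  then have "2 * Re p = cosh u"
    by (rule power2_eq_imp_eq) (use p in simp_all)
  then have "p = hyperbola_branch M u"
    using assms s by (simp add: hyperbola_branch_def complex_eq_iff)
  then show "p \<in> range (hyperbola_branch M)" by auto
qed

definition unduloid_profile :: "real \<Rightarrow> real \<Rightarrow> complex" where
  "unduloid_profile M = roll (ellipse M) (of_real (focal M))"

text \<open>The traces of the two foci of the hyperbola: the focus inside the rolling branch stays below
  the line, so its trace is reflected; the other one stays above the line.\<close>

definition nodoid_lower_arc :: "real \<Rightarrow> real \<Rightarrow> complex" where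
  "nodoid_lower_arc M u = cnj (roll (hyperbola_branch M) (of_real (focal M)) u)"

definition nodoid_upper_arc :: "real \<Rightarrow> real \<Rightarrow> complex" where
  "nodoid_upper_arc M = roll (hyperbola_branch M) (- of_real (focal M))"

text \<open>On the interval \<open>I\<close> the curve \<open>\<delta>\<close> is an orientation-preserving reparametrization of a
  translate, along the line, of the whole open arc \<open>\<beta>\<close>.\<close>

definition runs_along :: "(real \<Rightarrow> complex) \<Rightarrow> real set \<Rightarrow> (real \<Rightarrow> complex) \<Rightarrow> bool" where
  "runs_along \<delta> I \<beta> \<longleftrightarrow>
     (\<exists>(g :: real \<Rightarrow> real) (d :: real).
        (\<forall>s\<in>I. \<exists>g'>0. (g has_real_derivative g') (at s)) \<and> g ` I = UNIV \<and>
        (\<forall>s\<in>I. \<delta> s = \<beta> (g s) + of_real d))"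

text \<open>The smooth complete (unit speed, defined on the whole line) periodic curve alternately
  composed of copies of the two arcs; the joints are at \<open>0\<close> and \<open>l\<^sub>1\<close> modulo \<open>l\<^sub>1 + l\<^sub>2\<close>.\<close>

definition nodoid_profile :: "real \<Rightarrow> (real \<Rightarrow> complex) \<Rightarrow> bool" where
  "nodoid_profile M \<delta> \<longleftrightarrow>
     smooth \<delta> \<and> (\<forall>s. norm (vector_derivative \<delta> (at s)) = 1) \<and>
     (\<exists>l\<^sub>1>0. \<exists>l\<^sub>2>0. \<exists>P :: real.
        runs_along \<delta> {0<..<l\<^sub>1} (nodoid_lower_arc M) \<and>
        runs_along \<delta> {l\<^sub>1<..<l\<^sub>1 + l\<^sub>2} (nodoid_upper_arc M) \<and>
        (\<forall>s. \<delta> (s + (l\<^sub>1 + l\<^sub>2)) = \<delta> s + of_real P))"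

definition revolution :: "(real \<Rightarrow> complex) \<Rightarrow> real \<times> real \<Rightarrow> real ^ 3" where
  "revolution \<delta> = (\<lambda>(u, \<theta>). vector [Re (\<delta> u), Im (\<delta> u) * cos \<theta>, Im (\<delta> u) * sin \<theta>])"

text \<open>\<open>D\<close> is the Delaunay surface with parameter \<open>M\<close>, composed with its universal covering.
  The nodoid profile is determined up to translations along the line and of the arc length.\<close>

definition delaunay :: "real \<Rightarrow> (real \<times> real \<Rightarrow> real ^ 3) \<Rightarrow> bool" where
  "delaunay M D \<longleftrightarrow>
     - 1 / 4 < M \<and>
     (M < 0 \<and> D = revolution (unduloid_profile M) \<or>
      M > 0 \<and> (\<exists>\<delta>. nodoid_profile M \<delta> \<and> D = revolution \<delta>))"

end

theory Submission
  imports Defs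
begin

text \<open>All three surfaces carry a metric invariant under a one-parameter group, so up to shearing
  along the orbits it has the form \<open>d\<sigma>\<^sup>2 + G(\<sigma>) d\<tau>\<^sup>2\<close>, where \<open>\<sigma>\<close> is the
  arc length across the orbits and \<open>G\<close> the squared length of the generator.  The key fact is that for each
  of them \<open>G\<close> is a harmonic oscillation in \<open>\<sigma>\<close>: \<open>G = k (\<mu> - cos (2 \<sigma>))\<close>
  after a shift of \<open>\<sigma>\<close>.  A factor \<open>k\<close> can be absorbed by scaling \<open>\<tau>\<close> on
  the universal cover, so \<open>\<mu>\<close> alone decides the isometry class
  (\<open>isometric_of_pulls_back_model\<close>), and it remains to compute it for each surface.

  For a special Twizzler write \<open>R = \<xi>\<^sub>1\<^sup>2 + \<xi>\<^sub>2\<^sup>2\<close>.  The squared length of the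
  helices is \<open>1 + w\<^sup>2 R\<close>, the equation \<open>h\<^sub>w = 0\<close> expresses everything through \<open>R\<close>,
  and the condition on the mean curvature then turns \<open>1 - 2 R\<close> into the cosine of twice the arc length
  (\<open>special_twizzler_oscillator\<close>).  Hence \<open>\<mu> = 1 + 2 / w\<^sup>2 = (1 + v) / (1 - v)\<close>.  The
  same computation gives the Gauss curvature \<open>1 - (1 + w\<^sup>2) / (1 + w\<^sup>2 R)\<^sup>2\<close>; since \<open>R\<close>
  sweeps out \<open>[0, 1]\<close>, its extrema are \<open>1 - v\<close> and \<open>1 - 1 / v\<close>, of quotient \<open>- v\<close>.

  For a Delaunay surface let \<open>f\<close> be half the focal distance of the rolling conic.  The squared distance
  from the axis is \<open>f\<^sup>2 + 1/4 - f cos (2 \<sigma>)\<close>, for an ellipse as well as for both foci of a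
  hyperbola (\<open>conic_roulette\<close>), so \<open>\<mu> = f + 1 / (4 f)\<close>.  The two values
  \<open>f = (1 - \<surd>v) / (2 (1 + \<surd>v))\<close> and \<open>f = (1 + \<surd>v) / (2 (1 - \<surd>v))\<close> are the
  solutions of \<open>f + 1 / (4 f) = (1 + v) / (1 - v)\<close>.  They are exchanged by \<open>f \<mapsto> 1 / (4 f)\<close>,
  which is why each special Twizzler has an unduloid and a nodoid as isometric partners.

  The profile of the nodoid is only given as a smooth curve whose pieces run along the two focal arcs.  That it
  exists is shown by integrating the explicit arc length parametrization (\<open>nodoid_exists\<close>); that every
  such curve has the expected metric follows since the differential equation of \<open>G\<close> holds on the open
  pieces and extends over the joints by continuity (\<open>nodoid_pulls_back_model\<close>).\<close>

section \<open>Calculus of smooth maps\<close>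

lemma Ck_SucI:
  assumes "\<And>x. (f has_derivative D x) (at x)" "\<And>h. Ck k (\<lambda>x. D x h)"
  shows "Ck (Suc k) f"
proof -
  have "frechet_derivative f (at x) = D x" for x
    using frechet_derivative_at[OF assms(1)] by metis
  then show ?thesis using assms by (auto simp: differentiable_def)
qed

lemma Ck_SucD:
  assumes "Ck (Suc k) f"
  shows "(f has_derivative frechet_derivative f (at x)) (at x)"
    and "Ck k (\<lambda>x. frechet_derivative f (at x) h)"
  using assms by (simp_all add: frechet_derivative_works)

lemma Ck_continuous: "Ck k f \<Longrightarrow> continuous_on UNIV f"
  by (cases k) (simp_all add: continuous_at_imp_continuous_on differentiable_imp_continuous_within)

lemma Ck_lower: "Ck (Suc k) f \<Longrightarrow> Ck k f"
proof (induction k arbitrary: f)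
  case 0
  then show ?case using Ck_continuous[of "Suc 0" f] by simp
next
  case (Suc k)
  show ?case
    by (rule Ck_SucI[OF Ck_SucD(1)[OF Suc.prems]], rule Suc.IH, rule Ck_SucD(2)[OF Suc.prems])
qed

lemma Ck_const: "Ck k (\<lambda>x. c)"
  by (induction k arbitrary: c) (auto intro!: Ck_SucI[where D = "\<lambda>x h. 0"] simp del: Ck.simps(2))

lemma Ck_linear: "bounded_linear L \<Longrightarrow> Ck k L"
  by (cases k) (auto intro!: Ck_SucI[where D = "\<lambda>x h. L h"] Ck_const bounded_linear_imp_has_derivative
      linear_continuous_on simp del: Ck.simps(2))

lemma Ck_add: "Ck k f \<Longrightarrow> Ck k g \<Longrightarrow> Ck k (\<lambda>x. f x + g x)"
proof (induction k arbitrary: f g)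
  case 0
  then show ?case by (auto intro: continuous_intros)
next
  case (Suc k)
  note f = Ck_SucD[OF Suc.prems(1)] and g = Ck_SucD[OF Suc.prems(2)]
  show ?case
    by (rule Ck_SucI[OF has_derivative_add[OF f(1) g(1)]]) (rule Suc.IH[OF f(2) g(2)])
qed

text \<open>The Leibniz rule consists of bilinear terms again, with one factor differentiated; this is what the
  induction on the order feeds on.\<close>
lemma Ck_bilinear:
  assumes "bounded_bilinear B"
  shows "Ck k f \<Longrightarrow> Ck k g \<Longrightarrow> Ck k (\<lambda>x. B (f x) (g x))"
proof (induction k arbitrary: f g)
  case 0
  then show ?case using bounded_bilinear.continuous_on[OF assms] by auto
next
  case (Suc k)
  note f = Ck_SucD[OF Suc.prems(1)] and g = Ck_SucD[OF Suc.prems(2)]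
  show ?case
    by (rule Ck_SucI[OF bounded_bilinear.FDERIV[OF assms f(1) g(1)]])
      (intro Ck_add Suc.IH f(2) g(2) Ck_lower[OF Suc.prems(1)] Ck_lower[OF Suc.prems(2)])
qed

lemma has_derivative_compose_real:
  fixes f :: "real \<Rightarrow> 'b::real_normed_vector" and g :: "'a::real_normed_vector \<Rightarrow> real"
  assumes "(f has_derivative f') (at (g x))" "(g has_derivative g') (at x)"
  shows "((\<lambda>x. f (g x)) has_derivative (\<lambda>h. g' h *\<^sub>R f' 1)) (at x)"
proof -
  have "f' (g' h) = g' h *\<^sub>R f' 1" for h
    using linear_cmul[OF has_derivative_linear[OF assms(1)], of "g' h" 1] by simp
  then show ?thesis
    using has_derivative_compose[OF assms(2,1)] by presburger
qed

text \<open>For an outer function of one real variable the chain rule involves only the directional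
  derivative in the direction 1.  For several variables one would need the derivative to be
  smooth jointly in the point and the direction.\<close>

lemma Ck_compose:
  fixes f :: "real \<Rightarrow> 'b::real_normed_vector" and g :: "'a::real_normed_vector \<Rightarrow> real"
  shows "Ck k f \<Longrightarrow> Ck k g \<Longrightarrow> Ck k (\<lambda>x. f (g x))"
proof (induction k arbitrary: f)
  case 0
  then show ?case by (auto intro: continuous_on_compose2)
next
  case (Suc k)
  note f = Ck_SucD[OF Suc.prems(1)] and g = Ck_SucD[OF Suc.prems(2)]
  show ?case
    by (rule Ck_SucI[OF has_derivative_compose_real[OF f(1) g(1)]])
      (intro Ck_bilinear[OF bounded_bilinear_scaleR] g(2) Suc.IH f(2) Ck_lower[OF Suc.prems(2)])
qed

text \<open>The derivative of \<open>1 / f\<close> is \<open>- f' / f\<^sup>2\<close>, so its class is limited by the class of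
  \<open>1 / f\<close> one order lower.  The square root below bootstraps in the same way.\<close>
lemma Ck_inverse:
  fixes f :: "'a::real_normed_vector \<Rightarrow> real"
  assumes "\<And>x. f x \<noteq> 0"
  shows "Ck k f \<Longrightarrow> Ck k (\<lambda>x. inverse (f x))"
proof (induction k)
  case 0
  then show ?case using assms by (auto intro!: continuous_intros)
next
  case (Suc k)
  note f = Ck_SucD[OF Suc.prems]
  have [intro]: "Ck k (\<lambda>x. inverse (f x))" by (rule Suc.IH[OF Ck_lower[OF Suc.prems]])
  have D: "((\<lambda>x. inverse (f x)) has_derivative
      (\<lambda>h. (-1) * (inverse (f x) * frechet_derivative f (at x) h * inverse (f x)))) (at x)" for x
    using Deriv.has_derivative_inverse[OF assms f(1)] by simp
  show ?case
    by (rule Ck_SucI[OF D]) (intro Ck_bilinear[OF bounded_bilinear_mult] Ck_const f(2) ; blast)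
qed

lemma Ck_sqrt:
  fixes f :: "'a::real_normed_vector \<Rightarrow> real"
  assumes "\<And>x. f x > 0"
  shows "Ck k f \<Longrightarrow> Ck k (\<lambda>x. sqrt (f x))"
proof (induction k)
  case 0
  then show ?case by (auto intro!: continuous_intros)
next
  case (Suc k)
  note f = Ck_SucD[OF Suc.prems]
  have "Ck k (\<lambda>x. sqrt (f x))" by (rule Suc.IH[OF Ck_lower[OF Suc.prems]])
  then have i: "Ck k (\<lambda>x. inverse (sqrt (f x)))"
    using assms by (intro Ck_inverse) (simp_all add: order_less_imp_not_eq2)
  have D: "((\<lambda>x. sqrt (f x)) has_derivative
      (\<lambda>h. frechet_derivative f (at x) h * ((1/2) * inverse (sqrt (f x))))) (at x)" for x
    using has_derivative_compose_real[OF DERIV_real_sqrt[OF assms, THEN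
          has_field_derivative_imp_has_derivative] f(1)]
    by (simp add: field_simps)
  show ?case
    by (rule Ck_SucI[OF D]) (intro Ck_bilinear[OF bounded_bilinear_mult] Ck_const f(2) i)
qed

lemma smooth_const: "smooth (\<lambda>x. c)"
  and smooth_ident: "smooth (\<lambda>x. x)"
  and smooth_fst: "smooth fst"
  and smooth_snd: "smooth snd"
  by (simp_all add: smooth_def Ck_const Ck_linear bounded_linear_ident bounded_linear_fst
      bounded_linear_snd)

lemma smooth_add: "smooth f \<Longrightarrow> smooth g \<Longrightarrow> smooth (\<lambda>x. f x + g x)"
  by (simp add: smooth_def Ck_add)

lemma smooth_bilinear:
  "bounded_bilinear B \<Longrightarrow> smooth f \<Longrightarrow> smooth g \<Longrightarrow> smooth (\<lambda>x. B (f x) (g x))"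
  by (simp add: smooth_def Ck_bilinear)

lemmas smooth_mult = smooth_bilinear[OF bounded_bilinear_mult]
lemmas smooth_scaleR = smooth_bilinear[OF bounded_bilinear_scaleR]

lemma smooth_minus: "smooth f \<Longrightarrow> smooth (\<lambda>x. - f x)"
  using smooth_scaleR[OF smooth_const[of "-1"], of f] by simp

lemma smooth_diff: "smooth f \<Longrightarrow> smooth g \<Longrightarrow> smooth (\<lambda>x. f x - g x)"
  using smooth_add[OF _ smooth_minus, of f g] by simp

lemma smooth_power: "smooth f \<Longrightarrow> smooth (\<lambda>x. f x ^ n :: real)"
  by (induction n) (simp_all add: smooth_const smooth_mult)

lemma smooth_inverse:
  fixes f :: "'a::real_normed_vector \<Rightarrow> real"
  shows "smooth f \<Longrightarrow> (\<And>x. f x \<noteq> 0) \<Longrightarrow> smooth (\<lambda>x. inverse (f x))"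
  by (simp add: smooth_def Ck_inverse)

lemma smooth_divide:
  fixes f :: "'a::real_normed_vector \<Rightarrow> real"
  shows "smooth f \<Longrightarrow> smooth g \<Longrightarrow> (\<And>x. g x \<noteq> 0) \<Longrightarrow> smooth (\<lambda>x. f x / g x)"
  by (simp add: divide_inverse smooth_mult smooth_inverse)

lemma smooth_sqrt:
  fixes f :: "'a::real_normed_vector \<Rightarrow> real"
  shows "smooth f \<Longrightarrow> (\<And>x. f x > 0) \<Longrightarrow> smooth (\<lambda>x. sqrt (f x))"
  by (simp add: smooth_def Ck_sqrt)

lemma smooth_compose:
  fixes f :: "real \<Rightarrow> 'b::real_normed_vector" and g :: "'a::real_normed_vector \<Rightarrow> real"
  shows "smooth f \<Longrightarrow> smooth g \<Longrightarrow> smooth (\<lambda>x. f (g x))"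
  by (simp add: smooth_def Ck_compose)

lemma smooth_Pair:
  assumes "smooth f" "smooth g"
  shows "smooth (\<lambda>x. (f x :: real, g x :: real))"
proof -
  have "smooth (\<lambda>x. (f x :: real) *\<^sub>R (1::real, 0::real) + (g x :: real) *\<^sub>R (0::real, 1::real))"
    by (intro smooth_add smooth_scaleR smooth_const assms)
  then show ?thesis by simp
qed

lemma smooth_linear_image:
  assumes L: "bounded_linear L" and "smooth f"
  shows "smooth (\<lambda>x. L (f x))"
proof -
  have "Ck k f \<Longrightarrow> Ck k (\<lambda>x. L (f x))" for k
  proof (induction k arbitrary: f)
    case 0
    then show ?case using bounded_linear.continuous_on[OF L] by auto
  next
    case (Suc k)
    note f = Ck_SucD[OF Suc.prems]
    show ?case
      by (rule Ck_SucI[OF bounded_linear.has_derivative[OF L f(1)]]) (rule Suc.IH[OF f(2)])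
  qed
  then show ?thesis using assms(2) by (simp add: smooth_def)
qed

lemma smooth_has_derivative: "smooth f \<Longrightarrow> (f has_derivative frechet_derivative f (at x)) (at x)"
  unfolding smooth_def using Ck_SucD(1) by blast

text \<open>A function of one real variable is as smooth as its derivative plus one order; this avoids
  the directional derivatives of the general definition.\<close>

lemma Ck_vector_derivI:
  fixes f :: "real \<Rightarrow> 'b::real_normed_vector"
  assumes "\<And>x. (f has_vector_derivative f' x) (at x)" "Ck k f'"
  shows "Ck (Suc k) f"
proof (rule Ck_SucI)
  show "(f has_derivative (\<lambda>h. h *\<^sub>R f' x)) (at x)" for x
    using assms(1) by (simp add: has_vector_derivative_def)
  show "Ck k (\<lambda>x. h *\<^sub>R f' x)" for h
    by (rule Ck_bilinear[OF bounded_bilinear_scaleR Ck_const assms(2)])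
qed

lemma smooth_vector_derivI:
  assumes "\<And>x. (f has_vector_derivative f' x) (at x)" "smooth f'"
  shows "smooth f"
  unfolding smooth_def
proof
  fix k
  have "Ck (Suc k) f"
    using Ck_vector_derivI[OF assms(1)] assms(2) by (simp add: smooth_def)
  then show "Ck k f" by (rule Ck_lower)
qed

lemma smooth_has_vector_derivative:
  fixes f :: "real \<Rightarrow> 'b::real_normed_vector"
  assumes "smooth f"
  shows "(f has_vector_derivative vector_derivative f (at x)) (at x)"
  using smooth_has_derivative[OF assms, of x]
  by (meson differentiableI vector_derivative_works)

lemma smooth_vector_derivative:
  fixes f :: "real \<Rightarrow> 'b::real_normed_vector"
  assumes "smooth f"
  shows "smooth (\<lambda>x. vector_derivative f (at x))"
proof -
  have "vector_derivative f (at x) = frechet_derivative f (at x) 1" for x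
    using smooth_has_derivative[OF assms, of x] smooth_has_vector_derivative[OF assms, of x]
    by (metis frechet_derivative_at has_vector_derivative_def scaleR_one)
  then show ?thesis using assms by (auto simp: smooth_def intro!: Ck_SucD(2) simp del: Ck.simps)
qed

lemma smooth_DERIV:
  fixes f :: "real \<Rightarrow> real"
  assumes "smooth f"
  shows "(f has_real_derivative deriv f x) (at x)"
  using smooth_has_vector_derivative[OF assms, of x]
  by (metis DERIV_imp_deriv has_real_derivative_iff_has_vector_derivative)

lemma smooth_deriv:
  fixes f :: "real \<Rightarrow> real"
  assumes "smooth f"
  shows "smooth (deriv f)"
proof -
  have "deriv f = (\<lambda>x. vector_derivative f (at x))"
    using smooth_DERIV[OF assms]
    by (metis has_real_derivative_iff_has_vector_derivative vector_derivative_at)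
  then show ?thesis using smooth_vector_derivative[OF assms] by simp
qed

lemma smooth_DERIVI:
  fixes f :: "real \<Rightarrow> real"
  assumes "\<And>x. (f has_real_derivative f' x) (at x)" "smooth f'"
  shows "smooth f"
  using smooth_vector_derivI[of f f'] assms
  by (simp add: has_real_derivative_iff_has_vector_derivative)

lemma smooth_imp_DERIV_ex:
  fixes f :: "real \<Rightarrow> real"
  assumes "smooth f"
  obtains F where "\<And>x. (F has_real_derivative f x) (at x)" "smooth F"
proof -
  have "isCont f x" for x
    using assms Ck_continuous by (metis UNIV_I continuous_on_eq_continuous_at open_UNIV smooth_def)
  then have "\<exists>F. \<forall>x::real. -\<infinity> < ereal x \<longrightarrow> ereal x < \<infinity> \<longrightarrow> (F has_vector_derivative f x) (at x)"
    by (intro einterval_antiderivative) auto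
  then obtain F where "\<And>x. (F has_real_derivative f x) (at x)"
    by (auto simp: has_real_derivative_iff_has_vector_derivative)
  then show thesis using that smooth_DERIVI assms by blast
qed

lemma smooth_sin: "smooth (sin :: real \<Rightarrow> real)"
  and smooth_cos: "smooth (cos :: real \<Rightarrow> real)"
proof -
  have "Ck k (sin :: real \<Rightarrow> real) \<and> Ck k (cos :: real \<Rightarrow> real)" for k
  proof (induction k)
    case 0
    then show ?case by (auto intro: continuous_intros)
  next
    case (Suc k)
    have "Ck (Suc k) (sin :: real \<Rightarrow> real)"
      by (rule Ck_vector_derivI[of _ cos])
        (auto simp: Suc has_real_derivative_iff_has_vector_derivative[symmetric] simp del: Ck.simps)
    moreover have "Ck (Suc k) (cos :: real \<Rightarrow> real)"
    proof (rule Ck_vector_derivI[of _ "\<lambda>x. -1 * sin x"])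
      show "(cos has_vector_derivative -1 * sin x) (at x)" for x :: real
        by (auto simp: has_real_derivative_iff_has_vector_derivative[symmetric]
            intro!: derivative_eq_intros)
      show "Ck k (\<lambda>x::real. -1 * sin x)"
        using Suc by (intro Ck_bilinear[OF bounded_bilinear_mult] Ck_const) auto
    qed
    ultimately show ?case by blast
  qed
  then show "smooth (sin :: real \<Rightarrow> real)" "smooth (cos :: real \<Rightarrow> real)"
    by (simp_all add: smooth_def)
qed

text \<open>The derivative of an inverse function is again expressed by the inverse function, so that
  its differentiability class improves by one with every pass through this identity.\<close>

lemma smooth_inverse_function:
  fixes f g :: "real \<Rightarrow> real"
  assumes f: "smooth f" and pos: "\<And>x. deriv f x > 0" and fg: "\<And>y. f (g y) = y"
  shows "smooth g"
proof -
  have mono: "f x < f y" if "x < y" for x y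
    by (rule DERIV_pos_imp_increasing[OF that]) (use smooth_DERIV[OF f] pos in blast)
  then have gf: "g (f x) = x" for x
    by (metis fg less_irrefl linorder_neqE)
  have D: "(g has_real_derivative inverse (deriv f (g y))) (at y)" for y
  proof (rule DERIV_inverse_function[where f = f and a = "y - 1" and b = "y + 1"])
    have "isCont g (f (g y))"
      by (rule isCont_inverse_function[where d = 1])
        (simp_all add: gf DERIV_isCont[OF smooth_DERIV[OF f]])
    then show "isCont g y" by (simp add: fg)
  qed (use smooth_DERIV[OF f] pos[of "g y"] fg in auto)
  have "Ck k g" for k
  proof (induction k)
    case 0
    then show ?case using DERIV_isCont[OF D] by (simp add: continuous_at_imp_continuous_on)
  next
    case (Suc k)
    show ?case
    proof (rule Ck_vector_derivI)
      show "(g has_vector_derivative inverse (deriv f (g y))) (at y)" for y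
        using D by (simp add: has_real_derivative_iff_has_vector_derivative)
      have "Ck k (\<lambda>y. deriv f (g y))"
        using Ck_compose[of k "deriv f" g] Suc smooth_deriv[OF f] by (simp add: smooth_def)
      then show "Ck k (\<lambda>y. inverse (deriv f (g y)))"
        using pos by (intro Ck_inverse) (simp_all add: order_less_imp_not_eq2)
    qed
  qed
  then show ?thesis by (simp add: smooth_def)
qed

lemmas smooth_intros = smooth_const smooth_ident smooth_fst smooth_snd smooth_add smooth_minus
  smooth_diff smooth_mult smooth_power smooth_scaleR smooth_Pair smooth_deriv
  smooth_compose[OF smooth_sin] smooth_compose[OF smooth_cos]

text \<open>This is where completeness enters: an arc length whose density stays away from zero runs
  through the whole line, so that it can serve as a global coordinate.\<close>

lemma surj_of_deriv_ge:
  fixes f :: "real \<Rightarrow> real"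
  assumes D: "\<And>x. (f has_real_derivative f' x) (at x)" and "0 < e" "\<And>x. e \<le> f' x"
  shows "surj f"
proof -
  have grow: "f x + e * (y - x) \<le> f y" if xy: "x \<le> y" for x y
  proof -
    have "(\<lambda>t. f t - e * t) x \<le> (\<lambda>t. f t - e * t) y"
    proof (rule DERIV_nonneg_imp_nondecreasing[OF xy], intro exI conjI)
      show "((\<lambda>t. f t - e * t) has_real_derivative f' t - e * 1) (at t)" for t
        by (intro DERIV_diff D DERIV_cmult DERIV_ident)
      show "0 \<le> f' t - e * 1" for t using assms(3)[of t] by simp
    qed
    then show ?thesis by (simp add: algebra_simps)
  qed
  have "\<exists>x. f x = y" for y
  proof -
    define b where "b = \<bar>y - f 0\<bar> / e"
    have b: "b \<ge> 0" "e * b = \<bar>y - f 0\<bar>" using \<open>0 < e\<close> by (auto simp: b_def)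
    have "f 0 + e * b \<le> f b" "f (-b) + e * b \<le> f 0"
      using grow[of 0 b] grow[of "-b" 0] b by auto
    then have "f (-b) \<le> y" "y \<le> f b" using b by linarith+
    then show ?thesis using IVT[of f "-b" y b] b DERIV_isCont[OF D] by auto
  qed
  then show ?thesis by (metis surjI)
qed

section \<open>Isometry through a common model metric\<close>

text \<open>The metric is the pullback of \<open>d\<sigma>\<^sup>2 + k (\<mu> - cos (2 \<sigma>)) d\<tau>\<^sup>2\<close> under the
  diffeomorphism \<open>(s, t) \<mapsto> (\<sigma> s, t + \<tau> s)\<close> of the plane.  The scale \<open>k\<close> is existential
  because stretching the second coordinate changes it.\<close>
definition pulls_back_model :: "real \<Rightarrow> (real \<times> real \<Rightarrow> real ^ 3) \<Rightarrow> bool" where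
  "pulls_back_model \<mu> X \<longleftrightarrow>
     (\<exists>\<sigma> \<tau> k. smooth \<sigma> \<and> (\<forall>s. deriv \<sigma> s > 0) \<and> surj \<sigma> \<and> smooth \<tau> \<and> k > 0 \<and>
        (\<forall>s t a1 a2 b1 b2. induced_metric X (s, t) (a1, a2) (b1, b2) =
           (deriv \<sigma> s)\<^sup>2 * (a1 * b1) +
           k * (\<mu> - cos (2 * \<sigma> s)) * ((a2 + deriv \<tau> s * a1) * (b2 + deriv \<tau> s * b1))))"

text \<open>The isometry is one sheared coordinate system followed by the inverse of the other, with the second coordinate
  scaled by \<open>\<surd>(k / k')\<close> to match the two scales.  Such maps preserve the foliation by orbits, so
  bijectivity and smoothness of the inverse reduce to functions of one variable.\<close>
lemma isometric_of_pulls_back_model: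
  assumes "pulls_back_model \<mu> X" "pulls_back_model \<mu> Y"
  shows "isometric_planes X Y"
proof -
  obtain \<sigma> \<tau> k where \<sigma>: "smooth \<sigma>" "\<And>s. deriv \<sigma> s > 0" "surj \<sigma>" and \<tau>: "smooth \<tau>" and k: "k > 0"
    and X: "\<And>s t a1 a2 b1 b2. induced_metric X (s, t) (a1, a2) (b1, b2) =
           (deriv \<sigma> s)\<^sup>2 * (a1 * b1) +
           k * (\<mu> - cos (2 * \<sigma> s)) * ((a2 + deriv \<tau> s * a1) * (b2 + deriv \<tau> s * b1))"
    using assms(1) unfolding pulls_back_model_def by blast
  obtain \<sigma>' \<tau>' k' where \<sigma>': "smooth \<sigma>'" "\<And>s. deriv \<sigma>' s > 0" "surj \<sigma>'" and \<tau>': "smooth \<tau>'"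
    and k': "k' > 0"
    and Y: "\<And>s t a1 a2 b1 b2. induced_metric Y (s, t) (a1, a2) (b1, b2) =
           (deriv \<sigma>' s)\<^sup>2 * (a1 * b1) +
           k' * (\<mu> - cos (2 * \<sigma>' s)) * ((a2 + deriv \<tau>' s * a1) * (b2 + deriv \<tau>' s * b1))"
    using assms(2) unfolding pulls_back_model_def by blast
  \<comment> \<open>The arc length coordinates are increasing bijections of the line with smooth inverses.\<close>
  have inv: "inv f (f x) = x" "f (inv f y) = y" "smooth (inv f)"
    if "smooth f" "\<And>s. deriv f s > 0" "surj f" for f :: "real \<Rightarrow> real" and x y
  proof -
    have less: "f x < f y" if "x < y" for x y
      by (rule DERIV_pos_imp_increasing[OF \<open>x < y\<close>])
        (use smooth_DERIV[OF \<open>smooth f\<close>] \<open>\<And>s. deriv f s > 0\<close> in blast)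
    then have "inj f" by (metis injI less_irrefl linorder_neqE)
    then show "inv f (f x) = x" by simp
    show "f (inv f y) = y" by (simp add: surj_f_inv_f that)
    show "smooth (inv f)"
      by (rule smooth_inverse_function[OF that(1,2)]) (simp add: surj_f_inv_f that)
  qed
  note i = inv[OF \<sigma>] and i' = inv[OF \<sigma>']
  define \<phi> where "\<phi> = (\<lambda>s. inv \<sigma>' (\<sigma> s))"
  define \<psi> where "\<psi> = (\<lambda>s. inv \<sigma> (\<sigma>' s))"
  define l where "l = sqrt (k / k')"
  define \<rho> where "\<rho> = (\<lambda>s. l * \<tau> s - \<tau>' (\<phi> s))"
  have l: "l \<noteq> 0" "k' * l\<^sup>2 = k" using k k' by (auto simp: l_def)
  have \<phi>\<psi>: "\<phi> (\<psi> u) = u" "\<psi> (\<phi> s) = s" "\<sigma>' (\<phi> s) = \<sigma> s" for u s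
    by (simp_all add: \<phi>_def \<psi>_def i i')
  have sm: "smooth \<phi>" "smooth \<psi>" "smooth \<rho>"
  proof -
    show "smooth \<phi>" "smooth \<psi>"
      unfolding \<phi>_def \<psi>_def by (intro smooth_compose[OF i'(3) \<sigma>(1)] smooth_compose[OF i(3) \<sigma>'(1)])+
    then show "smooth \<rho>"
      unfolding \<rho>_def by (intro smooth_intros smooth_compose[OF \<tau>'] \<tau>)
  qed
  define \<Phi> where "\<Phi> = (\<lambda>p :: real \<times> real. (\<phi> (fst p), l * snd p + \<rho> (fst p)))"
  define \<Psi> where "\<Psi> = (\<lambda>p :: real \<times> real. (\<psi> (fst p), (snd p - \<rho> (\<psi> (fst p))) / l))"
  have \<Phi>\<Psi>: "\<Phi> (\<Psi> p) = p" "\<Psi> (\<Phi> p) = p" for p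
    using l by (auto simp: \<Phi>_def \<Psi>_def \<phi>\<psi>)
  then have bij: "bij \<Phi>" and inv\<Phi>: "inv \<Phi> = \<Psi>"
    by (metis bijI' , metis \<Phi>\<Psi> ext inv_equality)
  have "smooth \<Phi>" "smooth \<Psi>"
    unfolding \<Phi>_def \<Psi>_def divide_inverse
    by (intro smooth_intros smooth_compose[OF sm(1)] smooth_compose[OF sm(2)] smooth_compose[OF sm(3)])+
  moreover have "induced_metric X p a b =
      induced_metric Y (\<Phi> p) (frechet_derivative \<Phi> (at p) a) (frechet_derivative \<Phi> (at p) b)"
    for p a b
  proof -
    obtain s t a1 a2 b1 b2 where p: "p = (s, t)" "a = (a1, a2)" "b = (b1, b2)"
      by (metis surj_pair)
    define P where "P = deriv \<phi> s"
    define R where "R = l * deriv \<tau> s - deriv \<tau>' (\<phi> s) * P"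
    have D\<phi>: "(\<phi> has_real_derivative P) (at s)"
      unfolding P_def by (rule smooth_DERIV[OF sm(1)])
    have D\<rho>: "(\<rho> has_real_derivative R) (at s)"
      unfolding \<rho>_def R_def
      by (intro DERIV_diff DERIV_cmult smooth_DERIV[OF \<tau>] DERIV_chain2[OF smooth_DERIV[OF \<tau>'] D\<phi>])
    \<comment> \<open>Differentiating \<open>\<sigma>' \<circ> \<phi> = \<sigma>\<close> matches the arc length parts of the metrics.\<close>
    have P: "deriv \<sigma>' (\<phi> s) * P = deriv \<sigma> s"
    proof -
      have "((\<lambda>s. \<sigma>' (\<phi> s)) has_real_derivative deriv \<sigma>' (\<phi> s) * P) (at s)"
        by (rule DERIV_chain2[OF smooth_DERIV[OF \<sigma>'(1)] D\<phi>])
      then show ?thesis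
        by (simp add: \<phi>\<psi> DERIV_unique[OF _ smooth_DERIV[OF \<sigma>(1)]])
    qed
    have "(\<Phi> has_derivative (\<lambda>h. (fst h *\<^sub>R (P * 1), l * snd h + fst h *\<^sub>R (R * 1)))) (at (s, t))"
      unfolding \<Phi>_def
      using D\<phi> D\<rho> unfolding has_field_derivative_def
      by (intro has_derivative_Pair has_derivative_compose_real has_derivative_add
          has_derivative_mult_right has_derivative_fst has_derivative_snd has_derivative_ident)
        (simp_all)
    then have F: "frechet_derivative \<Phi> (at (s, t)) =
        (\<lambda>h. (fst h *\<^sub>R (P * 1), l * snd h + fst h *\<^sub>R (R * 1)))"
      by (rule frechet_derivative_at[symmetric])
    have tw: "l * x2 + x1 * R + deriv \<tau>' (\<phi> s) * (x1 * P) = l * (x2 + deriv \<tau> s * x1)" for x1 x2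
      by (simp add: R_def algebra_simps)
    have "induced_metric Y (\<Phi> p) (frechet_derivative \<Phi> (at p) a) (frechet_derivative \<Phi> (at p) b)
      = (deriv \<sigma>' (\<phi> s))\<^sup>2 * (a1 * P * (b1 * P)) + k' * (\<mu> - cos (2 * \<sigma> s)) *
         ((l * a2 + a1 * R + deriv \<tau>' (\<phi> s) * (a1 * P)) * (l * b2 + b1 * R + deriv \<tau>' (\<phi> s) * (b1 * P)))"
      unfolding p F by (simp add: \<Phi>_def Y \<phi>\<psi>)
    also have "\<dots> = (deriv \<sigma>' (\<phi> s) * P)\<^sup>2 * (a1 * b1) + (k' * l\<^sup>2) * (\<mu> - cos (2 * \<sigma> s)) *
         ((a2 + deriv \<tau> s * a1) * (b2 + deriv \<tau> s * b1))"
      unfolding tw by (simp add: power2_eq_square)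
    finally show ?thesis by (simp add: P l X p)
  qed
  ultimately show ?thesis
    unfolding isometric_planes_def using bij inv\<Phi> by blast
qed

text \<open>A solution of the rotation equation with angular speed \<open>2 v\<close>, seen in a frame rotating with it, is
  constant; its constant angle is the phase shift \<open>2 d\<close>.\<close>
lemma phase_lift:
  fixes c s :: "real \<Rightarrow> real"
  assumes "\<And>x. (c has_real_derivative - (2 * v x) * s x) (at x)"
    and "\<And>x. (s has_real_derivative (2 * v x) * c x) (at x)"
    and "c x0 ^ 2 + s x0 ^ 2 = 1"
    and \<sigma>: "\<And>x. (\<sigma> has_real_derivative v x) (at x)"
  shows "\<exists>d. \<forall>x. c x = cos (2 * (\<sigma> x + d))"
proof -
  \<comment> \<open>The coordinates \<open>a\<close> and \<open>b\<close> refer to the rotating frame.\<close>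
  define a where "a = (\<lambda>x. c x * cos (2 * \<sigma> x) + s x * sin (2 * \<sigma> x))"
  define b where "b = (\<lambda>x. s x * cos (2 * \<sigma> x) - c x * sin (2 * \<sigma> x))"
  have "(a has_real_derivative 0) (at x)" "(b has_real_derivative 0) (at x)" for x
    unfolding a_def b_def
    by (rule derivative_eq_intros assms refl | simp add: algebra_simps)+
  then have ab: "a x = a x0" "b x = b x0" for x
    by (metis DERIV_isconst_all)+
  have sc: "(cos (2 * \<sigma> x))\<^sup>2 + (sin (2 * \<sigma> x))\<^sup>2 = 1" for x by simp
  have alg: "(p * C + q * S) * C - (q * C - p * S) * S = p * (C\<^sup>2 + S\<^sup>2)"
    "(p * C + q * S)\<^sup>2 + (q * C - p * S)\<^sup>2 = (p\<^sup>2 + q\<^sup>2) * (C\<^sup>2 + S\<^sup>2)" for p q C S :: real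
    by (simp_all add: algebra_simps power2_eq_square)
  have c: "c x = a x * cos (2 * \<sigma> x) - b x * sin (2 * \<sigma> x)" for x
    unfolding a_def b_def alg sc by simp
  have "(a x0)\<^sup>2 + (b x0)\<^sup>2 = 1"
    unfolding a_def b_def alg sc using assms(3) by simp
  then obtain e where e: "a x0 = cos e" "b x0 = sin e"
    using sincos_total_2pi by metis
  have "c x = cos (2 * (\<sigma> x + e / 2))" for x
  proof -
    have "2 * (\<sigma> x + e / 2) = 2 * \<sigma> x + e" by simp
    then show ?thesis by (simp only: c[of x] ab[of x] e cos_add) simp
  qed
  then show ?thesis by blast
qed

lemma oscillator_phase:
  assumes "smooth v" "0 < e" "\<And>s. e \<le> v s"
    and C: "\<And>s. (C has_real_derivative - (2 * v s) * S s) (at s)"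
      "\<And>s. (S has_real_derivative (2 * v s) * C s) (at s)" "\<And>s. (C s)\<^sup>2 + (S s)\<^sup>2 = 1"
  obtains \<sigma> where "\<And>s. (\<sigma> has_real_derivative v s) (at s)" "smooth \<sigma>" "surj \<sigma>"
    "\<And>s. C s = cos (2 * \<sigma> s)"
proof -
  obtain \<sigma>0 where \<sigma>0: "\<And>s. (\<sigma>0 has_real_derivative v s) (at s)"
    using smooth_imp_DERIV_ex[OF assms(1)] by blast
  obtain d where d: "\<And>s. C s = cos (2 * (\<sigma>0 s + d))"
    using phase_lift[OF C(1,2) C(3) \<sigma>0] by blast
  have D: "((\<lambda>s. \<sigma>0 s + d) has_real_derivative v s) (at s)" for s
    using DERIV_add[OF \<sigma>0 DERIV_const] by simp
  show ?thesis
    by (rule that[OF D smooth_DERIVI[OF D assms(1)] surj_of_deriv_ge[OF D assms(2,3)] d])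
qed

text \<open>Completing the square in the second coordinate leaves \<open>(E - F\<^sup>2 / G) ds\<^sup>2\<close>, so
  \<open>v\<close> is the speed of the arc length across the orbits and the shear is a primitive of \<open>F / G\<close>.\<close>
lemma pulls_back_modelI:
  assumes metric: "\<And>s t a1 a2 b1 b2. induced_metric X (s, t) (a1, a2) (b1, b2) =
      E s * (a1 * b1) + F s * (a1 * b2 + a2 * b1) + G s * (a2 * b2)"
    and smooth: "smooth F" "smooth G" "smooth v"
    and speed: "\<And>s. E s * G s - (F s)\<^sup>2 = (v s)\<^sup>2 * G s" "0 < e" "\<And>s. e \<le> v s"
    and G: "\<And>s. G s = k * (\<mu> - C s)" "0 < k" "1 < \<mu>"
    and C: "\<And>s. (C has_real_derivative - (2 * v s) * S s) (at s)"
      "\<And>s. (S has_real_derivative (2 * v s) * C s) (at s)" "\<And>s. (C s)\<^sup>2 + (S s)\<^sup>2 = 1"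
  shows "pulls_back_model \<mu> X"
proof -
  obtain \<sigma> where D\<sigma>: "\<And>s. (\<sigma> has_real_derivative v s) (at s)" "smooth \<sigma>" "surj \<sigma>"
    and d: "\<And>s. C s = cos (2 * \<sigma> s)"
    using oscillator_phase[OF smooth(3) speed(2,3) C] by blast
  have "C s \<le> 1" for s by (simp add: d)
  then have "C s < \<mu>" for s using G(3) by (rule le_less_trans)
  then have Gpos: "G s > 0" for s by (simp add: G(1,2))
  then have "smooth (\<lambda>s. F s / G s)"
    by (intro smooth_divide smooth) (simp add: order_less_imp_not_eq2)
  then obtain \<tau> where \<tau>: "\<And>s. (\<tau> has_real_derivative F s / G s) (at s)" "smooth \<tau>"
    using smooth_imp_DERIV_ex by blast
  have [simp]: "deriv \<sigma> s = v s" "deriv \<tau> s = F s / G s" for s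
    using D\<sigma>(1) \<tau>(1) by (auto intro: DERIV_imp_deriv)
  have "v s > 0" for s using speed(2) speed(3)[of s] by linarith
  moreover have "induced_metric X (s, t) (a1, a2) (b1, b2) = (deriv \<sigma> s)\<^sup>2 * (a1 * b1) +
           k * (\<mu> - cos (2 * \<sigma> s)) * ((a2 + deriv \<tau> s * a1) * (b2 + deriv \<tau> s * b1))"
    for s t a1 a2 b1 b2
  proof -
    have "G s \<noteq> 0" using Gpos[of s] by simp
    then have "E s = (v s)\<^sup>2 + (F s)\<^sup>2 / G s"
      using speed(1)[of s] by (simp add: field_simps)
    then have "induced_metric X (s, t) (a1, a2) (b1, b2) = (v s)\<^sup>2 * (a1 * b1) +
        G s * ((a2 + F s / G s * a1) * (b2 + F s / G s * b1))"
      using \<open>G s \<noteq> 0\<close> unfolding metric by (simp add: field_simps power2_eq_square)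
    moreover have "k * (\<mu> - cos (2 * \<sigma> s)) = G s" by (simp add: G(1) d)
    ultimately show ?thesis by simp
  qed
  ultimately show ?thesis
    unfolding pulls_back_model_def using D\<sigma>(2,3) \<tau>(2) G(2) by (intro exI[of _ \<sigma>] exI[of _ \<tau>] exI[of _ k]) simp
qed

section \<open>Derivatives of maps into three-space\<close>

lemma vector3_eq: "(vector [a, b, c] :: real ^ 3) = a *\<^sub>R axis 1 1 + b *\<^sub>R axis 2 1 + c *\<^sub>R axis 3 1"
  by (simp add: vec_eq_iff forall_3 axis_def)

lemma has_derivative_vector3:
  assumes "(f has_derivative f') F" "(g has_derivative g') F" "(h has_derivative h') F"
  shows "((\<lambda>p. vector [f p, g p, h p] :: real ^ 3) has_derivative (\<lambda>q. vector [f' q, g' q, h' q])) F"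
  unfolding vector3_eq by (intro has_derivative_add has_derivative_scaleR_left assms)

lemma inner_vector3:
  "(vector [a, b, c] :: real ^ 3) \<bullet> vector [a', b', c'] = a * a' + b * b' + c * c'"
  by (simp add: inner_vec_def sum_3)

text \<open>Once the derivative is known in coordinates, both the partial derivatives and the metric can be read
  off.\<close>
lemma pd_of_has_derivative:
  assumes "(X has_derivative (\<lambda>h. fst h *\<^sub>R U + snd h *\<^sub>R V)) (at p)"
  shows "pd 1 X p = U" "pd 2 X p = V"
    and "induced_metric X p (a1, a2) (b1, b2) =
      (U \<bullet> U) * (a1 * b1) + (U \<bullet> V) * (a1 * b2 + a2 * b1) + (V \<bullet> V) * (a2 * b2)"
proof -
  have "frechet_derivative X (at p) = (\<lambda>h. fst h *\<^sub>R U + snd h *\<^sub>R V)"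
    by (rule frechet_derivative_at[OF assms, symmetric])
  then show "pd 1 X p = U" "pd 2 X p = V"
    "induced_metric X p (a1, a2) (b1, b2) =
      (U \<bullet> U) * (a1 * b1) + (U \<bullet> V) * (a1 * b2 + a2 * b1) + (V \<bullet> V) * (a2 * b2)"
    by (simp_all add: pd_def coord_vec_def induced_metric_def inner_add_left inner_add_right
        inner_commute algebra_simps)
qed

lemma induced_metric_revolution:
  assumes "(\<delta> has_vector_derivative \<delta>') (at s)"
  shows "induced_metric (revolution \<delta>) (s, t) (a1, a2) (b1, b2) =
    (norm \<delta>')\<^sup>2 * (a1 * b1) + 0 * (a1 * b2 + a2 * b1) + (Im (\<delta> s))\<^sup>2 * (a2 * b2)"
proof -
  have D: "((\<lambda>s. Re (\<delta> s)) has_real_derivative Re \<delta>') (at s)"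
    "((\<lambda>s. Im (\<delta> s)) has_real_derivative Im \<delta>') (at s)"
    using assms has_vector_derivative_complex_iff by blast+
  have D2: "((\<lambda>p. Re (\<delta> (fst p))) has_derivative (\<lambda>h. fst h *\<^sub>R (Re \<delta>' * 1))) (at (s, t))"
    "((\<lambda>p. Im (\<delta> (fst p))) has_derivative (\<lambda>h. fst h *\<^sub>R (Im \<delta>' * 1))) (at (s, t))"
    by (intro has_derivative_compose_real[where g = fst] has_derivative_fst has_derivative_ident;
        use D[THEN has_field_derivative_imp_has_derivative] in simp)+
  have "(revolution \<delta> has_derivative (\<lambda>h. fst h *\<^sub>R vector [Re \<delta>', Im \<delta>' * cos t, Im \<delta>' * sin t] +
      snd h *\<^sub>R vector [0, - Im (\<delta> s) * sin t, Im (\<delta> s) * cos t])) (at (s, t))"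
    unfolding revolution_def case_prod_unfold
    by (rule has_derivative_eq_rhs, rule has_derivative_vector3, rule D2(1),
        (rule has_derivative_mult D2 has_derivative_cos has_derivative_sin has_derivative_snd
          has_derivative_ident)+)
      (auto simp: vec_eq_iff forall_3 algebra_simps fun_eq_iff)
  note this [THEN pd_of_has_derivative(3), of a1 a2 b1 b2]
  moreover have "(norm \<delta>')\<^sup>2 = Re \<delta>' * Re \<delta>' + Im \<delta>' * Im \<delta>'"
    unfolding cmod_power2 by (simp add: power2_eq_square)
  moreover have "(Im \<delta>' * cos t) * (Im \<delta>' * cos t) + (Im \<delta>' * sin t) * (Im \<delta>' * sin t) = Im \<delta>' * Im \<delta>'"
    "(Im (\<delta> s) * sin t) * (Im (\<delta> s) * sin t) + (Im (\<delta> s) * cos t) * (Im (\<delta> s) * cos t)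
       = Im (\<delta> s) * Im (\<delta> s)"
    using sin_cos_squared_add[of t] by algebra+
  ultimately show ?thesis
    by (simp add: inner_vector3 power2_eq_square)
qed

section \<open>Fundamental forms of a helicoidal surface\<close>

lemma mult_matrix_inv:
  fixes A :: "real ^ 'n ^ 'n"
  assumes "det A \<noteq> 0"
  shows "A ** matrix_inv A = mat 1"
  using assms someI_ex[of "\<lambda>J. A ** J = mat 1 \<and> J ** A = mat 1"]
  unfolding matrix_inv_def invertible_det_nz[symmetric] invertible_def by blast

lemma matrix_inv_2:
  fixes A :: "real ^ 2 ^ 2"
  assumes "det A \<noteq> 0"
  shows "matrix_inv A = (\<chi> i j. (if i = j then A $ (3 - i) $ (3 - i) else - A $ i $ j) / det A)"
    (is "_ = ?J")
proof -
  have A: "A $ 1 $ 1 * A $ 2 $ 2 - A $ 1 $ 2 * A $ 2 $ 1 = det A" by (simp add: det_2)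
  have "?J ** A = mat 1"
    using assms A
    by (simp add: vec_eq_iff forall_2 matrix_matrix_mult_def sum_2 mat_def field_simps)
  then have "?J ** (A ** matrix_inv A) = matrix_inv A"
    by (simp add: matrix_mul_assoc)
  then show ?thesis
    by (simp add: mult_matrix_inv[OF assms])
qed

lemma trace_det_inv_mult_2:
  fixes A B :: "real ^ 2 ^ 2"
  assumes "det A \<noteq> 0"
  shows "trace (matrix_inv A ** B) =
      (A $ 2 $ 2 * B $ 1 $ 1 - A $ 1 $ 2 * B $ 2 $ 1 - A $ 2 $ 1 * B $ 1 $ 2 + A $ 1 $ 1 * B $ 2 $ 2) / det A"
    and "det (matrix_inv A ** B) = det B / det A"
proof -
  show "trace (matrix_inv A ** B) =
      (A $ 2 $ 2 * B $ 1 $ 1 - A $ 1 $ 2 * B $ 2 $ 1 - A $ 2 $ 1 * B $ 1 $ 2 + A $ 1 $ 1 * B $ 2 $ 2) / det A"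
    using assms
    by (simp add: matrix_inv_2 trace_def matrix_matrix_mult_def sum_2 field_simps)
  have "det (matrix_inv A) * det A = 1"
    using mult_matrix_inv[OF assms] by (metis det_I det_mul mult.commute)
  then show "det (matrix_inv A ** B) = det B / det A"
    using assms by (simp add: det_mul field_simps)
qed

text \<open>A vector field along the surface that depends on \<open>s\<close> only up to the screw rotation, with a
  component along the axis depending on \<open>t\<close>.  This class contains a Twizzler itself and is closed under
  partial derivatives and cross products, so all derivatives are computed by one rule.\<close>
definition helix_field ::
  "real \<Rightarrow> (real \<Rightarrow> real) \<Rightarrow> (real \<Rightarrow> real) \<Rightarrow> (real \<Rightarrow> real) \<Rightarrow> real \<times> real \<Rightarrow> real ^ 3" where
  "helix_field w a b n p =
     vector [a (fst p) * cos (w * snd p) + b (fst p) * sin (w * snd p),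
             n (snd p),
             - a (fst p) * sin (w * snd p) + b (fst p) * cos (w * snd p)]"

lemma helix_field_has_derivative:
  assumes "(a has_real_derivative a' (fst p)) (at (fst p))"
    "(b has_real_derivative b' (fst p)) (at (fst p))" "(n has_real_derivative n' (snd p)) (at (snd p))"
  shows "(helix_field w a b n has_derivative
    (\<lambda>h. fst h *\<^sub>R helix_field w a' b' (\<lambda>t. 0) p +
         snd h *\<^sub>R helix_field w (\<lambda>s. w * b s) (\<lambda>s. - w * a s) n' p)) (at p)"
proof -
  have fs: "(fst has_derivative fst) (at p)" "(snd has_derivative snd) (at p)"
    by (simp_all add: bounded_linear_imp_has_derivative bounded_linear_fst bounded_linear_snd)
  note d = assms[THEN has_field_derivative_imp_has_derivative]
  have 1: "((\<lambda>p. a (fst p)) has_derivative (\<lambda>h. fst h * a' (fst p))) (at p)"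
    "((\<lambda>p. b (fst p)) has_derivative (\<lambda>h. fst h * b' (fst p))) (at p)"
    "((\<lambda>p. n (snd p)) has_derivative (\<lambda>h. snd h * n' (snd p))) (at p)"
    using has_derivative_compose_real[OF d(1) fs(1)] has_derivative_compose_real[OF d(2) fs(1)]
      has_derivative_compose_real[OF d(3) fs(2)] by simp_all
  note t = has_derivative_mult_right[OF fs(2), of w]
  note c = has_derivative_compose_real[OF DERIV_cos[THEN has_field_derivative_imp_has_derivative] t]
    and s = has_derivative_compose_real[OF DERIV_sin[THEN has_field_derivative_imp_has_derivative] t]
  show ?thesis
    unfolding helix_field_def[abs_def]
    by (rule has_derivative_eq_rhs[OF has_derivative_vector3[OF
          has_derivative_add[OF has_derivative_mult[OF 1(1) c] has_derivative_mult[OF 1(2) s]] 1(3)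
          has_derivative_add[OF has_derivative_mult[OF has_derivative_minus[OF 1(1)] s]
            has_derivative_mult[OF 1(2) c]]]])
      (simp add: vec_eq_iff forall_3 fun_eq_iff algebra_simps)
qed

lemma pd_helix_field:
  assumes "\<And>s. (a has_real_derivative a' s) (at s)" "\<And>s. (b has_real_derivative b' s) (at s)"
    "\<And>t. (n has_real_derivative n' t) (at t)"
  shows "pd 1 (helix_field w a b n) = helix_field w a' b' (\<lambda>t. 0)"
    and "pd 2 (helix_field w a b n) = helix_field w (\<lambda>s. w * b s) (\<lambda>s. - w * a s) n'"
  using pd_of_has_derivative(1,2)[OF helix_field_has_derivative[of a a' _ b b' n n' w]] assms by auto

text \<open>The frame rotates with the screw motion, so inner and cross products are computed as if
  the angle were zero.\<close>

lemma helix_field_products: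
  shows "helix_field w a b n p \<bullet> helix_field w a' b' n' p =
      a (fst p) * a' (fst p) + b (fst p) * b' (fst p) + n (snd p) * n' (snd p)"
    and "cross3 (helix_field w a b n p) (helix_field w a' b' n' p) =
      helix_field w (\<lambda>s. n (snd p) * b' s - b s * n' (snd p)) (\<lambda>s. a s * n' (snd p) - n (snd p) * a' s)
        (\<lambda>t. b (fst p) * a' (fst p) - a (fst p) * b' (fst p)) p"
proof -
  have alg: "(A * C + B * S) * (A' * C + B' * S) + N * N' + (- A * S + B * C) * (- A' * S + B' * C)
      = (A * A' + B * B') * (C\<^sup>2 + S\<^sup>2) + N * N'"
    "(- A * S + B * C) * (A' * C + B' * S) - (A * C + B * S) * (- A' * S + B' * C)
      = (B * A' - A * B') * (C\<^sup>2 + S\<^sup>2)" for A B A' B' C S N N' :: real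
    by (simp_all add: algebra_simps power2_eq_square)
  show "helix_field w a b n p \<bullet> helix_field w a' b' n' p =
      a (fst p) * a' (fst p) + b (fst p) * b' (fst p) + n (snd p) * n' (snd p)"
    unfolding helix_field_def inner_vector3 alg by simp
  show "cross3 (helix_field w a b n p) (helix_field w a' b' n' p) =
      helix_field w (\<lambda>s. n (snd p) * b' s - b s * n' (snd p)) (\<lambda>s. a s * n' (snd p) - n (snd p) * a' s)
        (\<lambda>t. b (fst p) * a' (fst p) - a (fst p) * b' (fst p)) p"
    unfolding cross3_def helix_field_def vec_eq_iff forall_3 vector_3 alg
    by (simp add: algebra_simps)
qed

lemma twizzler_map_eq_helix_field: "twizzler_map w x z = helix_field w x z (\<lambda>t. t)"
  by (simp add: twizzler_map_def helix_field_def fun_eq_iff)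

text \<open>Here \<open>\<kappa>\<close> is the curvature of the profile curve, \<open>A\<close> the area density, and
  \<open>q\<close> the squared length of the coordinate field tangent to the helices.\<close>

lemma twizzler_map_forms:
  fixes x z :: "real \<Rightarrow> real" and w s t :: real
  assumes "smooth x" "smooth z" and unit: "\<And>s. (deriv x s)\<^sup>2 + (deriv z s)\<^sup>2 = 1"
  defines "\<kappa> \<equiv> deriv x s * deriv (deriv z) s - deriv z s * deriv (deriv x) s"
  defines "A \<equiv> sqrt (1 + w\<^sup>2 * (xi1 x z s)\<^sup>2)"
  defines "q \<equiv> 1 + w\<^sup>2 * ((xi1 x z s)\<^sup>2 + (xi2 x z s)\<^sup>2)"
  shows "induced_metric (twizzler_map w x z) (s, t) (a1, a2) (b1, b2) =
      1 * (a1 * b1) + w * xi2 x z s * (a1 * b2 + a2 * b1) + q * (a2 * b2)"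
    and "mean_curvature (twizzler_map w x z) (s, t) = (\<kappa> * q + w\<^sup>2 * xi2 x z s) / (2 * A ^ 3)"
    and "gauss_curvature (twizzler_map w x z) (s, t) = - w\<^sup>2 * (1 + \<kappa> * xi2 x z s) / A ^ 4"
proof -
  let ?f = "twizzler_map w x z"
  have D: "(x has_real_derivative deriv x s) (at s)" "(z has_real_derivative deriv z s) (at s)"
    "(deriv x has_real_derivative deriv (deriv x) s) (at s)"
    "(deriv z has_real_derivative deriv (deriv z) s) (at s)" for s
    using assms by (auto intro: smooth_DERIV smooth_deriv)
  note D1 = D(1,2) DERIV_ident and D2 = D(3,4) DERIV_const
    and D3 = DERIV_cmult[OF D(2), of w] DERIV_cmult[OF D(1), of "- w"] DERIV_const[where k = 1]
  have pd1: "pd 1 ?f = helix_field w (deriv x) (deriv z) (\<lambda>t. 0)"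
    and pd2: "pd 2 ?f = helix_field w (\<lambda>s. w * z s) (\<lambda>s. - w * x s) (\<lambda>t. 1)"
    unfolding twizzler_map_eq_helix_field by (rule pd_helix_field D1)+
  have pd11: "pd 1 (pd 1 ?f) = helix_field w (deriv (deriv x)) (deriv (deriv z)) (\<lambda>t. 0)"
    and pd21: "pd 2 (pd 1 ?f) = helix_field w (\<lambda>s. w * deriv z s) (\<lambda>s. - w * deriv x s) (\<lambda>t. 0)"
    unfolding pd1 by (rule pd_helix_field D2)+
  have pd12: "pd 1 (pd 2 ?f) = helix_field w (\<lambda>s. w * deriv z s) (\<lambda>s. - w * deriv x s) (\<lambda>t. 0)"
    and pd22: "pd 2 (pd 2 ?f) =
      helix_field w (\<lambda>s. w * (- w * x s)) (\<lambda>s. - w * (w * z s)) (\<lambda>t. 0)"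
    unfolding pd2 by (rule pd_helix_field D3)+
  have R: "(x s)\<^sup>2 + (z s)\<^sup>2 = (xi1 x z s)\<^sup>2 + (xi2 x z s)\<^sup>2"
  proof -
    have "(xi1 x z s)\<^sup>2 + (xi2 x z s)\<^sup>2
        = ((x s)\<^sup>2 + (z s)\<^sup>2) * ((deriv x s)\<^sup>2 + (deriv z s)\<^sup>2)"
      by (simp add: xi1_def xi2_def algebra_simps power2_eq_square)
    then show ?thesis by (simp add: unit)
  qed
  have I: "pd 1 ?f (s, t) \<bullet> pd 1 ?f (s, t) = 1" "pd 1 ?f (s, t) \<bullet> pd 2 ?f (s, t) = w * xi2 x z s"
    "pd 2 ?f (s, t) \<bullet> pd 1 ?f (s, t) = w * xi2 x z s" "pd 2 ?f (s, t) \<bullet> pd 2 ?f (s, t) = q"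
  proof -
    show "pd 1 ?f (s, t) \<bullet> pd 1 ?f (s, t) = 1"
      using unit[of s] by (simp add: pd1 helix_field_products power2_eq_square)
    show "pd 1 ?f (s, t) \<bullet> pd 2 ?f (s, t) = w * xi2 x z s" "pd 2 ?f (s, t) \<bullet> pd 1 ?f (s, t) = w * xi2 x z s"
      by (simp_all add: pd1 pd2 helix_field_products xi2_def algebra_simps)
    have "pd 2 ?f (s, t) \<bullet> pd 2 ?f (s, t) = 1 + w\<^sup>2 * ((x s)\<^sup>2 + (z s)\<^sup>2)"
      by (simp add: pd2 helix_field_products power2_eq_square algebra_simps)
    then show "pd 2 ?f (s, t) \<bullet> pd 2 ?f (s, t) = q" by (simp add: R q_def)
  qed
  have "(?f has_derivative (\<lambda>h. fst h *\<^sub>R pd 1 ?f (s, t) + snd h *\<^sub>R pd 2 ?f (s, t))) (at (s, t))"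
    unfolding pd1 pd2 unfolding twizzler_map_eq_helix_field
    by (rule helix_field_has_derivative) (simp_all add: D)
  from pd_of_has_derivative(3)[OF this]
  show "induced_metric ?f (s, t) (a1, a2) (b1, b2) =
      1 * (a1 * b1) + w * xi2 x z s * (a1 * b2 + a2 * b1) + q * (a2 * b2)"
    by (simp add: I)
  have A: "A > 0" "A\<^sup>2 = 1 + w\<^sup>2 * (xi1 x z s)\<^sup>2"
    unfolding A_def by (simp_all add: add_pos_nonneg)
  define N where "N = helix_field w (\<lambda>s. - deriv z s) (deriv x) (\<lambda>t. w * xi1 x z s)"
  have cross: "cross3 (pd 1 ?f (s, t)) (pd 2 ?f (s, t)) = N (s, t)"
    unfolding pd1 pd2 helix_field_products N_def
    by (simp add: helix_field_def xi1_def algebra_simps)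
  have "N (s, t) \<bullet> N (s, t) = A\<^sup>2"
    using unit[of s] unfolding N_def helix_field_products A(2)
    by (simp add: power2_eq_square algebra_simps)
  then have normN: "norm (N (s, t)) = A"
    using A(1) by (simp add: norm_eq_sqrt_inner)
  have nu: "v \<bullet> unit_normal ?f (s, t) = (v \<bullet> N (s, t)) / A" for v
    by (simp add: unit_normal_def cross sgn_div_norm normN field_simps)
  have II: "pd 1 (pd 1 ?f) (s, t) \<bullet> unit_normal ?f (s, t) = \<kappa> / A"
    "pd 1 (pd 2 ?f) (s, t) \<bullet> unit_normal ?f (s, t) = - w / A"
    "pd 2 (pd 1 ?f) (s, t) \<bullet> unit_normal ?f (s, t) = - w / A"
    "pd 2 (pd 2 ?f) (s, t) \<bullet> unit_normal ?f (s, t) = - w\<^sup>2 * xi2 x z s / A"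
  proof -
    show "pd 1 (pd 1 ?f) (s, t) \<bullet> unit_normal ?f (s, t) = \<kappa> / A"
      unfolding nu pd11 unfolding N_def helix_field_products by (simp add: \<kappa>_def algebra_simps)
    have "w * deriv z s * - deriv z s + - w * deriv x s * deriv x s + 0 = - w"
      using unit[of s] by (simp add: power2_eq_square) algebra
    then show "pd 1 (pd 2 ?f) (s, t) \<bullet> unit_normal ?f (s, t) = - w / A"
      "pd 2 (pd 1 ?f) (s, t) \<bullet> unit_normal ?f (s, t) = - w / A"
      unfolding nu pd12 pd21 unfolding N_def helix_field_products by simp_all
    show "pd 2 (pd 2 ?f) (s, t) \<bullet> unit_normal ?f (s, t) = - w\<^sup>2 * xi2 x z s / A"
      unfolding nu pd22 unfolding N_def helix_field_products
      by (simp add: xi2_def power2_eq_square algebra_simps)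
  qed
  let ?I = "first_form ?f (s, t)" and ?II = "second_form ?f (s, t)"
  have I': "?I $ 1 $ 1 = 1" "?I $ 1 $ 2 = w * xi2 x z s" "?I $ 2 $ 1 = w * xi2 x z s" "?I $ 2 $ 2 = q"
    by (simp_all add: first_form_def I)
  have II': "?II $ 1 $ 1 = \<kappa> / A" "?II $ 1 $ 2 = - w / A" "?II $ 2 $ 1 = - w / A"
    "?II $ 2 $ 2 = - w\<^sup>2 * xi2 x z s / A"
    by (simp_all only: second_form_def II vec_lambda_beta)
  have dI: "det ?I = A\<^sup>2"
    unfolding det_2 I' A(2) by (simp add: q_def power2_eq_square algebra_simps)
  then have "det ?I \<noteq> 0" using A(1) by simp
  note tr = trace_det_inv_mult_2[OF this, of ?II, unfolded dI, unfolded I' II']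
  show "mean_curvature ?f (s, t) = (\<kappa> * q + w\<^sup>2 * xi2 x z s) / (2 * A ^ 3)"
    unfolding mean_curvature_def shape_operator_def tr(1) using A(1)
    by (simp add: field_simps power2_eq_square power3_eq_cube)
  have "det ?II = - w\<^sup>2 * (1 + \<kappa> * xi2 x z s) / A\<^sup>2"
    unfolding det_2 II' using A(1) by (simp add: field_simps power2_eq_square)
  then show "gauss_curvature ?f (s, t) = - w\<^sup>2 * (1 + \<kappa> * xi2 x z s) / A ^ 4"
    unfolding gauss_curvature_def shape_operator_def tr(2) by simp
qed

section \<open>The special Twizzlers\<close>

text \<open>The Frenet equations give \<open>\<xi>\<^sub>1' = 1 + \<kappa> \<xi>\<^sub>2\<close> and \<open>\<xi>\<^sub>2' = - \<kappa> \<xi>\<^sub>1\<close>,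
  whence \<open>R' = 2 \<xi>\<^sub>1\<close>.  With \<open>A\<close> the area density, the equation \<open>h\<^sub>w = 0\<close> says
  \<open>\<xi>\<^sub>2 = - A R\<close>, so \<open>A\<close>, \<open>\<xi>\<^sub>1\<^sup>2\<close> and, through the mean curvature,
  also \<open>\<kappa> \<xi>\<^sub>2\<close> are functions of \<open>R\<close>.  The area density divided by the length of the helices is
  \<open>1 / B\<close>, which is therefore the speed of arc length across the helices; relative to it
  \<open>(C, S)\<close> moves on the unit circle with angular speed 2.\<close>
lemma special_twizzler_oscillator:
  fixes x z :: "real \<Rightarrow> real"
  assumes profile: "twizzler_profile 0 v x z"
  defines "w \<equiv> pitch v"
  defines "R \<equiv> \<lambda>s. (xi1 x z s)\<^sup>2 + (xi2 x z s)\<^sup>2"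
  defines "B \<equiv> \<lambda>s. sqrt (1 + w\<^sup>2 * (R s)\<^sup>2)"
  defines "C \<equiv> \<lambda>s. 1 - 2 * R s" and "S \<equiv> \<lambda>s. 2 * xi1 x z s * B s"
  shows "smooth (xi1 x z)" "smooth (xi2 x z)" "smooth (\<lambda>s. inverse (B s))"
    and "1 / sqrt (1 + w\<^sup>2) \<le> inverse (B s)"
    and "(C has_real_derivative - (2 * inverse (B s)) * S s) (at s)"
    and "(S has_real_derivative (2 * inverse (B s)) * C s) (at s)"
    and "(C s)\<^sup>2 + (S s)\<^sup>2 = 1"
    and "(1 + w\<^sup>2 * R s) - (w * xi2 x z s)\<^sup>2 = (inverse (B s))\<^sup>2 * (1 + w\<^sup>2 * R s)"
    and "gauss_curvature (twizzler_map w x z) (s, t) = 1 - (1 + w\<^sup>2) / (1 + w\<^sup>2 * R s)\<^sup>2"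
proof -
  have smooth: "smooth x" "smooth z"
    and unit: "\<And>s. (deriv x s)\<^sup>2 + (deriv z s)\<^sup>2 = 1"
    and H: "\<And>p. mean_curvature (twizzler_map w x z) p = 1"
    and h: "\<And>s. h_fun w (xi1 x z s) (xi2 x z s) = 0"
    using profile by (auto simp: twizzler_profile_def w_def)
  define \<kappa> where "\<kappa> = (\<lambda>s. deriv x s * deriv (deriv z) s - deriv z s * deriv (deriv x) s)"
  define A where "A = (\<lambda>s. sqrt (1 + w\<^sup>2 * (xi1 x z s)\<^sup>2))"
  have D: "(x has_real_derivative deriv x s) (at s)" "(z has_real_derivative deriv z s) (at s)"
    "(deriv x has_real_derivative deriv (deriv x) s) (at s)"
    "(deriv z has_real_derivative deriv (deriv z) s) (at s)" for s
    using smooth by (auto intro: smooth_DERIV smooth_deriv)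
  have ortho: "deriv x s * deriv (deriv x) s + deriv z s * deriv (deriv z) s = 0" for s
  proof -
    have "((\<lambda>s. (deriv x s)\<^sup>2 + (deriv z s)\<^sup>2) has_real_derivative
        2 * (deriv x s * deriv (deriv x) s + deriv z s * deriv (deriv z) s)) (at s)"
      by (rule derivative_eq_intros D refl | simp)+
    from DERIV_unique[OF this[unfolded unit] DERIV_const] show ?thesis by simp
  qed
  have frenet: "deriv (deriv x) s = - \<kappa> s * deriv z s" "deriv (deriv z) s = \<kappa> s * deriv x s" for s
    using ortho[of s] unit[of s] unfolding \<kappa>_def by algebra+
  have D1: "(xi1 x z has_real_derivative 1 + \<kappa> s * xi2 x z s) (at s)" for s
  proof -
    have "(xi1 x z has_real_derivative (deriv x s * deriv x s + x s * deriv (deriv x) s) +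
        (deriv z s * deriv z s + z s * deriv (deriv z) s)) (at s)"
      unfolding xi1_def[abs_def] by (rule derivative_eq_intros D refl | simp)+
    moreover have "(deriv x s * deriv x s + x s * deriv (deriv x) s) +
        (deriv z s * deriv z s + z s * deriv (deriv z) s) = 1 + \<kappa> s * xi2 x z s"
      using unit[of s] by (simp add: frenet xi2_def power2_eq_square algebra_simps)
    ultimately show ?thesis by simp
  qed
  have D2: "(xi2 x z has_real_derivative - \<kappa> s * xi1 x z s) (at s)" for s
  proof -
    have "(xi2 x z has_real_derivative - (deriv x s * deriv z s + x s * deriv (deriv z) s) +
        (deriv z s * deriv x s + z s * deriv (deriv x) s)) (at s)"
      unfolding xi2_def[abs_def] by (rule derivative_eq_intros D refl | simp)+
    moreover have "- (deriv x s * deriv z s + x s * deriv (deriv z) s) +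
        (deriv z s * deriv x s + z s * deriv (deriv x) s) = - \<kappa> s * xi1 x z s"
      by (simp add: frenet xi1_def algebra_simps)
    ultimately show ?thesis by simp
  qed
  have DR: "(R has_real_derivative 2 * xi1 x z s) (at s)" for s
    unfolding R_def by (rule derivative_eq_intros D1 D2 refl | simp add: algebra_simps)+
  show sm: "smooth (xi1 x z)" "smooth (xi2 x z)"
    unfolding xi1_def[abs_def] xi2_def[abs_def] by (intro smooth_intros smooth)+
  have B2: "(B s)\<^sup>2 = 1 + w\<^sup>2 * (R s)\<^sup>2" "B s > 0" for s
    by (simp_all add: B_def add_pos_nonneg)
  have A2: "(A s)\<^sup>2 = 1 + w\<^sup>2 * (xi1 x z s)\<^sup>2" "A s > 0" for s
    by (simp_all add: A_def add_pos_nonneg)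
  show "smooth (\<lambda>s. inverse (B s))"
    using B2(2) unfolding B_def R_def
    by (intro smooth_inverse smooth_sqrt smooth_intros sm) (auto simp: add_pos_nonneg order_less_imp_not_eq2)
  have xi2: "xi2 x z s = - A s * R s" for s
  proof -
    have "R s + xi2 x z s / A s = 0" using h[of s] by (simp add: h_fun_def R_def A_def)
    then have "A s * R s + xi2 x z s = 0" using A2(2)[of s] by (simp add: field_simps)
    then show ?thesis by linarith
  qed
  have xi1sq: "(xi1 x z s)\<^sup>2 = R s - (A s * R s)\<^sup>2" for s
  proof -
    have "(xi2 x z s)\<^sup>2 = (A s * R s)\<^sup>2" by (simp only: xi2 power_mult_distrib power2_minus)
    then show ?thesis by (simp add: R_def)
  qed
  \<comment> \<open>The next facts express \<open>A\<close>, \<open>\<xi>\<^sub>1\<close> and \<open>\<xi>\<^sub>1'\<close> by \<open>R\<close>.\<close>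
  have q: "(A s)\<^sup>2 * (B s)\<^sup>2 = 1 + w\<^sup>2 * R s" for s
  proof -
    show ?thesis using xi1sq[of s] A2(1)[of s] B2(1)[of s] by algebra
  qed
  then have q_pos: "1 + w\<^sup>2 * R s > 0" for s
    using A2(2)[of s] B2(2)[of s] by (metis mult_pos_pos zero_less_power)
  have xi1: "(xi1 x z s)\<^sup>2 * (B s)\<^sup>2 = R s * (1 - R s)" for s
  proof -
    show ?thesis using xi1sq[of s] q[of s] B2(1)[of s] by algebra
  qed
  have D1': "1 + \<kappa> s * xi2 x z s = (1 - 2 * R s - w\<^sup>2 * (R s)\<^sup>2) / (B s) ^ 4" for s
  proof -
    have "(\<kappa> s * (1 + w\<^sup>2 * R s) + w\<^sup>2 * xi2 x z s) / (2 * A s ^ 3) = 1"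
      using twizzler_map_forms(2)[OF smooth unit, of w s 0] unfolding H \<kappa>_def A_def R_def by (rule sym)
    then have mean: "\<kappa> s * (1 + w\<^sup>2 * R s) + w\<^sup>2 * xi2 x z s = 2 * A s ^ 3"
      using A2(2)[of s] by (simp add: field_simps)
    have "(A s)\<^sup>2 * (B s)\<^sup>2 * (1 + \<kappa> s * xi2 x z s) = (A s)\<^sup>2 - 2 * (A s) ^ 4 * R s"
      using mean q[of s] xi2[of s] B2(1)[of s] by algebra
    then have "(A s)\<^sup>2 * ((B s)\<^sup>2 * (1 + \<kappa> s * xi2 x z s) - (1 - 2 * (A s)\<^sup>2 * R s)) = 0"
      by (simp add: algebra_simps power4_eq_xxxx power2_eq_square)
    then have "(B s)\<^sup>2 * (1 + \<kappa> s * xi2 x z s) = 1 - 2 * (A s)\<^sup>2 * R s"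
      using A2(2)[of s] by simp
    then have "(B s) ^ 4 * (1 + \<kappa> s * xi2 x z s) = 1 - 2 * R s - w\<^sup>2 * (R s)\<^sup>2"
      using q[of s] B2(1)[of s] by algebra
    then show ?thesis using B2(2)[of s] by (simp add: field_simps)
  qed
  have R01: "0 \<le> R s" "R s \<le> 1" for s
  proof -
    show "0 \<le> R s" by (simp add: R_def)
    have "0 \<le> R s * (1 - R s)" unfolding xi1[symmetric] by simp
    then show "R s \<le> 1" by (cases "R s = 0") (use \<open>0 \<le> R s\<close> in \<open>auto simp: zero_le_mult_iff\<close>)
  qed
  show "1 / sqrt (1 + w\<^sup>2) \<le> inverse (B s)"
  proof -
    have "B s \<le> sqrt (1 + w\<^sup>2)"
      unfolding B_def using R01[of s] by (simp add: mult_left_le power_le_one)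
    then show ?thesis using B2(2)[of s] by (simp add: divide_inverse le_imp_inverse_le)
  qed
  show "(C has_real_derivative - (2 * inverse (B s)) * S s) (at s)"
  proof -
    have "(C has_real_derivative 0 - 2 * (2 * xi1 x z s)) (at s)"
      unfolding C_def by (intro DERIV_diff DERIV_const DERIV_cmult DR)
    then show ?thesis using B2(2)[of s] by (simp add: S_def field_simps)
  qed
  show "(S has_real_derivative (2 * inverse (B s)) * C s) (at s)"
  proof -
    have "(B has_real_derivative (w\<^sup>2 * (2 * R s * (2 * xi1 x z s))) * (inverse (B s) / 2)) (at s)"
      unfolding B_def
      by (rule derivative_eq_intros DR refl | use B2(2)[of s] in \<open>simp add: B_def field_simps\<close>)+
    then have "(S has_real_derivative 2 * (1 + \<kappa> s * xi2 x z s) * B s +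
        w\<^sup>2 * (2 * R s * (2 * xi1 x z s)) * (inverse (B s) / 2) * (2 * xi1 x z s)) (at s)"
      unfolding S_def by (intro DERIV_mult DERIV_cmult D1)
    moreover have "2 * (1 + \<kappa> s * xi2 x z s) * B s +
        w\<^sup>2 * (2 * R s * (2 * xi1 x z s)) * (inverse (B s) / 2) * (2 * xi1 x z s)
       = (2 * inverse (B s)) * C s"
    proof -
      have num: "(1 - 2 * R s - w\<^sup>2 * (R s)\<^sup>2) + 2 * w\<^sup>2 * R s * ((xi1 x z s)\<^sup>2 * (B s)\<^sup>2)
          = (B s)\<^sup>2 * (1 - 2 * R s)"
        unfolding xi1 unfolding B2(1) by (simp add: algebra_simps power2_eq_square)
      have "2 * (1 + \<kappa> s * xi2 x z s) * B s +
          w\<^sup>2 * (2 * R s * (2 * xi1 x z s)) * (inverse (B s) / 2) * (2 * xi1 x z s)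
        = 2 / (B s) ^ 3 * ((1 - 2 * R s - w\<^sup>2 * (R s)\<^sup>2) +
            2 * w\<^sup>2 * R s * ((xi1 x z s)\<^sup>2 * (B s)\<^sup>2))"
        unfolding D1' using B2(2)[of s]
        by (simp add: field_simps power2_eq_square power3_eq_cube power4_eq_xxxx)
      also have "\<dots> = (2 * inverse (B s)) * C s"
        unfolding num C_def using B2(2)[of s] by (simp add: field_simps power2_eq_square power3_eq_cube)
      finally show ?thesis .
    qed
    ultimately show ?thesis by simp
  qed
  show "(C s)\<^sup>2 + (S s)\<^sup>2 = 1"
  proof -
    have "(S s)\<^sup>2 = 4 * ((xi1 x z s)\<^sup>2 * (B s)\<^sup>2)" by (simp add: S_def power_mult_distrib)
    then show ?thesis unfolding xi1 C_def by (simp add: algebra_simps power2_eq_square)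
  qed
  show "(1 + w\<^sup>2 * R s) - (w * xi2 x z s)\<^sup>2 = (inverse (B s))\<^sup>2 * (1 + w\<^sup>2 * R s)"
  proof -
    have "(1 + w\<^sup>2 * R s) - (w * xi2 x z s)\<^sup>2 = (A s)\<^sup>2"
      using q[of s] xi2[of s] B2(1)[of s] by algebra
    then show ?thesis unfolding q[symmetric] using B2(2)[of s]
      by (simp add: field_simps power2_eq_square)
  qed
  show "gauss_curvature (twizzler_map w x z) (s, t) = 1 - (1 + w\<^sup>2) / (1 + w\<^sup>2 * R s)\<^sup>2"
  proof -
    have "gauss_curvature (twizzler_map w x z) (s, t) = - w\<^sup>2 * (1 + \<kappa> s * xi2 x z s) / A s ^ 4"
      using twizzler_map_forms(3)[OF smooth unit, of w s t] by (simp add: \<kappa>_def A_def)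
    also have "\<dots> = - w\<^sup>2 * (1 - 2 * R s - w\<^sup>2 * (R s)\<^sup>2) / ((A s)\<^sup>2 * (B s)\<^sup>2)\<^sup>2"
      unfolding D1' using A2(2)[of s] B2(2)[of s]
      by (simp add: field_simps power2_eq_square power4_eq_xxxx)
    also have "\<dots> = ((1 + w\<^sup>2 * R s)\<^sup>2 - (1 + w\<^sup>2)) / (1 + w\<^sup>2 * R s)\<^sup>2"
      unfolding q by (simp add: algebra_simps power2_eq_square)
    also have "\<dots> = 1 - (1 + w\<^sup>2) / (1 + w\<^sup>2 * R s)\<^sup>2"
      using q_pos[of s] by (simp add: diff_divide_distrib)
    finally show ?thesis .
  qed
qed

lemma pitch_square: "0 < v \<Longrightarrow> v < 1 \<Longrightarrow> (pitch v)\<^sup>2 = (1 - v) / v"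
  by (simp add: pitch_def)

lemma special_twizzler_pulls_back_model:
  assumes v: "0 < v" "v < 1" and "special_twizzler v X"
  shows "pulls_back_model ((1 + v) / (1 - v)) X"
proof -
  obtain x z where profile: "twizzler_profile 0 v x z" and X: "X = twizzler_map (pitch v) x z"
    using assms by (auto simp: special_twizzler_def twizzler_def)
  define w where "w = pitch v"
  have w: "w\<^sup>2 = (1 - v) / v" using pitch_square[OF v] by (simp add: w_def)
  note osc = special_twizzler_oscillator[OF profile, folded w_def]
  have smooth: "smooth x" "smooth z" and unit: "\<And>s. (deriv x s)\<^sup>2 + (deriv z s)\<^sup>2 = 1"
    using profile by (auto simp: twizzler_profile_def)
  show ?thesis
    unfolding X w_def[symmetric]
  proof (rule pulls_back_modelI[OF twizzler_map_forms(1)[OF smooth unit] _ _ osc(3) _ _ osc(4) _ _ _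
        osc(5-7)])
    show "smooth (\<lambda>s. w * xi2 x z s)"
      "smooth (\<lambda>s. 1 + w\<^sup>2 * ((xi1 x z s)\<^sup>2 + (xi2 x z s)\<^sup>2))"
      by (intro smooth_intros osc(1,2))+
    show "1 + w\<^sup>2 * ((xi1 x z s)\<^sup>2 + (xi2 x z s)\<^sup>2) = w\<^sup>2 / 2 *
        ((1 + v) / (1 - v) - (1 - 2 * ((xi1 x z s)\<^sup>2 + (xi2 x z s)\<^sup>2)))" for s
      unfolding w using v by (simp add: field_simps)
  qed (use v w osc(8) in \<open>simp_all add: add_pos_nonneg\<close>)
qed

text \<open>The curvature increases with \<open>R\<close>, and \<open>R\<close> attains its bounds 0 and 1 because the phase
  \<open>\<sigma>\<close> is surjective.\<close>
lemma special_twizzler_gauss_curvature_ratio: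
  assumes v: "0 < v" "v < 1" and "special_twizzler v X"
  shows "\<exists>p q. (\<forall>r. gauss_curvature X r \<le> gauss_curvature X p) \<and>
               (\<forall>r. gauss_curvature X q \<le> gauss_curvature X r) \<and>
               gauss_curvature X p / gauss_curvature X q = - v"
proof -
  obtain x z where profile: "twizzler_profile 0 v x z" and X: "X = twizzler_map (pitch v) x z"
    using assms by (auto simp: special_twizzler_def twizzler_def)
  define w where "w = pitch v"
  have w: "w\<^sup>2 = (1 - v) / v" using pitch_square[OF v] by (simp add: w_def)
  have w1: "1 + w\<^sup>2 = 1 / v" "w\<^sup>2 > 0" using v by (simp_all add: w field_simps)
  note osc = special_twizzler_oscillator[OF profile, folded w_def]
  define R where "R = (\<lambda>s. (xi1 x z s)\<^sup>2 + (xi2 x z s)\<^sup>2)"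
  have K: "gauss_curvature X (s, t) = 1 - (1 + w\<^sup>2) / (1 + w\<^sup>2 * R s)\<^sup>2" for s t
    using osc(9) by (simp add: X R_def w_def)
  have "0 < 1 / sqrt (1 + w\<^sup>2)" by (simp add: add_pos_nonneg)
  then obtain \<sigma> :: "real \<Rightarrow> real" where "surj \<sigma>" and \<sigma>: "\<And>s. 1 - 2 * R s = cos (2 * \<sigma> s)"
    using oscillator_phase[OF osc(3) _ osc(4) osc(5-7)] unfolding R_def by metis
  obtain s0 s1 where s: "\<sigma> s0 = 0" "\<sigma> s1 = pi / 2" using \<open>surj \<sigma>\<close> by (metis surjD)
  have R: "R s0 = 0" "R s1 = 1" using \<sigma>[of s0] \<sigma>[of s1] by (simp_all add: s)
  have R01: "0 \<le> R s" "R s \<le> 1" for s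
    using \<sigma>[of s] cos_le_one[of "2 * \<sigma> s"] cos_ge_minus_one[of "2 * \<sigma> s"] by linarith+
  have Km: "gauss_curvature X (s1, 0) = 1 - v" "gauss_curvature X (s0, 0) = 1 - 1 / v"
    unfolding K R mult_1_right mult_zero_right w1(1) using v by (simp_all add: power2_eq_square)
  have "1 \<le> (1 + w\<^sup>2 * R s)\<^sup>2" "(1 + w\<^sup>2 * R s)\<^sup>2 \<le> (1 / v)\<^sup>2" for s
    using R01[of s] w1 by (auto intro!: power_mono simp: w1(1)[symmetric] mult_left_le)
  then have "1 - 1 / v \<le> gauss_curvature X (s, t)" "gauss_curvature X (s, t) \<le> 1 - v" for s t
    unfolding K w1(1) using v
  proof -
    define Q where "Q = (1 + w\<^sup>2 * R s)\<^sup>2"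
    assume "\<And>s. 1 \<le> (1 + w\<^sup>2 * R s)\<^sup>2" "\<And>s. (1 + w\<^sup>2 * R s)\<^sup>2 \<le> (1 / v)\<^sup>2"
    then have Q: "1 \<le> Q" "Q \<le> (1 / v)\<^sup>2" by (simp_all add: Q_def)
    have "(1 / v) / Q \<le> (1 / v) / 1" "(1 / v) / (1 / v)\<^sup>2 \<le> (1 / v) / Q"
      using Q v by (intro divide_left_mono; simp)+
    moreover have "(1 / v) / (1 / v)\<^sup>2 = v" using v by (simp add: power2_eq_square)
    ultimately show "1 - 1 / v \<le> 1 - 1 / v / (1 + w\<^sup>2 * R s)\<^sup>2" "1 - 1 / v / (1 + w\<^sup>2 * R s)\<^sup>2 \<le> 1 - v"
      by (simp_all add: Q_def)
  qed
  moreover have "(1 - v) / (1 - 1 / v) = - v" using v by (simp add: field_simps)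
  ultimately show ?thesis
    by (intro exI[of _ "(s1, 0)"] exI[of _ "(s0, 0)"]) (auto simp: Km)
qed

section \<open>Roulettes of conics\<close>

lemma arclen_DERIV:
  assumes "\<And>u. (\<gamma> has_vector_derivative \<gamma>' u) (at u)" and cont: "continuous_on UNIV (\<lambda>u. norm (\<gamma>' u))"
  shows "(arclen \<gamma> has_real_derivative norm (\<gamma>' u)) (at u)"
proof -
  have "isCont (\<lambda>u. norm (\<gamma>' u)) u" for u
    using cont by (simp add: continuous_on_eq_continuous_at)
  then have "\<exists>F. \<forall>x::real. -\<infinity> < ereal x \<longrightarrow> ereal x < \<infinity> \<longrightarrow>
      (F has_vector_derivative norm (\<gamma>' x)) (at x)"
    by (intro einterval_antiderivative) auto
  then obtain F where F: "\<And>u. (F has_vector_derivative norm (\<gamma>' u)) (at u)" by auto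
  have "arclen \<gamma> u = F u - F 0" for u
  proof -
    have "arclen \<gamma> u = (LBINT \<tau>=ereal 0..ereal u. norm (\<gamma>' \<tau>))"
      using assms(1)[THEN vector_derivative_at] by (simp add: arclen_def zero_ereal_def)
    also have "\<dots> = F u - F 0"
      by (rule interval_integral_FTC_finite[OF continuous_on_subset[OF cont subset_UNIV]
            has_vector_derivative_at_within[OF F]])
    finally show ?thesis .
  qed
  then have "arclen \<gamma> = (\<lambda>u. F u - F 0)" by auto
  moreover have "((\<lambda>u. F u - F 0) has_real_derivative norm (\<gamma>' u) - 0) (at u)"
    using F[of u] by (intro DERIV_diff DERIV_const) (simp add: has_real_derivative_iff_has_vector_derivative)
  ultimately show ?thesis by simp
qed

text \<open>In the moving frame of the line, the pole has the tangential and normal components of \<open>q - \<gamma> u\<close>.\<close>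
lemma roll_eq:
  assumes "(\<gamma> has_vector_derivative \<gamma>') (at u)"
  shows "roll \<gamma> q u = Complex
    (arclen \<gamma> u + (Re (q - \<gamma> u) * Re \<gamma>' + Im (q - \<gamma> u) * Im \<gamma>') / norm \<gamma>')
    ((Im (q - \<gamma> u) * Re \<gamma>' - Re (q - \<gamma> u) * Im \<gamma>') / norm \<gamma>')"
  by (simp add: roll_def vector_derivative_at[OF assms] complex_eq_iff sgn_div_norm
      divide_inverse algebra_simps)

lemma has_vector_derivative_Complex:
  assumes "(x has_real_derivative x') (at u)" "(y has_real_derivative y') (at u)"
  shows "((\<lambda>u. Complex (x u) (y u)) has_vector_derivative Complex x' y') (at u)"
  using assms by (simp add: has_vector_derivative_complex_iff)

text \<open>One computation covers the three focal arcs.  The sign \<open>\<epsilon>\<close> is \<open>-1\<close> for an ellipse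
  and \<open>1\<close> for a hyperbola; for a hyperbola, \<open>\<eta>\<close> is \<open>1\<close> for the focus inside the
  rolling branch and \<open>-1\<close> for the other one, and for the ellipse it is \<open>1\<close>.  In the standard
  parametrization, \<open>g - \<eta> / 2\<close> and \<open>P\<close> are \<open>f cos u\<close> and \<open>f sin u\<close>, or their
  hyperbolic analogues; \<open>g\<close> and \<open>\<epsilon> (g - \<eta>)\<close> are the distances of the contact point
  from the two foci, and \<open>Q g\<close> is the speed of the rolling conic.

  The trace of the focus has speed \<open>b / (2 g)\<close>, and \<open>(C, S)\<close> is the point of the unit circle whose
  angle is, up to a constant, twice the arc length of the trace.  For the ellipse this angle is the eccentric anomaly
  belonging to the true anomaly \<open>u\<close> in the Kepler problem of eccentricity \<open>2 f\<close>.\<close>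
lemma conic_roulette:
  fixes L P g :: "real \<Rightarrow> real" and f b \<epsilon> \<eta> :: real
  assumes sign: "\<epsilon>\<^sup>2 = 1" "\<eta>\<^sup>2 = 1" and fb: "f > 0" "b > 0" "b\<^sup>2 = \<epsilon> * (f\<^sup>2 - 1/4)"
    and g: "\<And>u. g u > 0" "\<And>u. \<epsilon> * (1 - \<eta> / g u) > 0"
    and P: "\<And>u. (P u)\<^sup>2 = \<epsilon> * ((g u - \<eta> / 2)\<^sup>2 - f\<^sup>2)"
  defines "Q \<equiv> \<lambda>u. sqrt (\<epsilon> * (1 - \<eta> / g u))"
  assumes D: "\<And>u. (P has_real_derivative g u - \<eta> / 2) (at u)"
    "\<And>u. (g has_real_derivative \<epsilon> * P u) (at u)" "\<And>u. (L has_real_derivative Q u * g u) (at u)"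
  defines "\<beta> \<equiv> \<lambda>u. Complex (L u - P u * Q u) (b * Q u)"
  defines "v \<equiv> \<lambda>u. b / (2 * g u)"
  defines "C \<equiv> \<lambda>u. (1/2 + \<eta> * (f\<^sup>2 - 1/4) / g u) / f" and "S \<equiv> \<lambda>u. \<eta> * b * P u / (f * g u)"
  shows "(\<beta> has_vector_derivative Complex (\<eta> * b\<^sup>2 / (2 * Q u * (g u)\<^sup>2)) (\<eta> * b * P u / (2 * Q u * (g u)\<^sup>2))) (at u)"
    and "norm (Complex (\<eta> * b\<^sup>2 / (2 * Q u * (g u)\<^sup>2)) (\<eta> * b * P u / (2 * Q u * (g u)\<^sup>2))) = v u"
    and "(Im (\<beta> u))\<^sup>2 = f * ((f\<^sup>2 + 1/4) / f - C u)"
    and "(C has_real_derivative - (2 * v u) * S u) (at u)"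
    and "(S has_real_derivative (2 * v u) * C u) (at u)"
    and "(C u)\<^sup>2 + (S u)\<^sup>2 = 1"
proof -
  have gu: "g u > 0" "g u \<noteq> 0" using g(1)[of u] by simp_all
  have Q: "(Q u)\<^sup>2 = \<epsilon> * (1 - \<eta> / g u)" "Q u > 0"
    using g(2)[of u] by (simp_all add: Q_def)
  have Qg: "(Q u)\<^sup>2 * (g u)\<^sup>2 = \<epsilon> * ((g u)\<^sup>2 - \<eta> * g u)"
    unfolding Q using gu by (simp add: field_simps power2_eq_square)
  have bP: "b\<^sup>2 + (P u)\<^sup>2 = (Q u)\<^sup>2 * (g u)\<^sup>2"
    unfolding Qg fb(3) P using sign(2) by (simp add: algebra_simps power2_eq_square)
  have DQ: "(Q has_real_derivative \<eta> * P u / (2 * Q u * (g u)\<^sup>2)) (at u)"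
  proof -
    have "((\<lambda>u. \<epsilon> * (1 - \<eta> / g u)) has_real_derivative \<epsilon> * (\<eta> * (\<epsilon> * P u) / (g u)\<^sup>2)) (at u)"
      by (rule derivative_eq_intros D refl | use gu in \<open>simp add: power2_eq_square\<close>)+
    then have "(Q has_real_derivative inverse (sqrt (\<epsilon> * (1 - \<eta> / g u))) / 2 *
        (\<epsilon> * (\<eta> * (\<epsilon> * P u) / (g u)\<^sup>2))) (at u)"
      unfolding Q_def 
      by (rule DERIV_chain2[where g = "\<lambda>u. \<epsilon> * (1 - \<eta> / g u)", OF DERIV_real_sqrt[OF g(2)[of u]]])
    moreover have "inverse (Q u) / 2 * (\<epsilon> * (\<eta> * (\<epsilon> * P u) / (g u)\<^sup>2)) =
        \<epsilon>\<^sup>2 * (\<eta> * P u / (2 * Q u * (g u)\<^sup>2))"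
      using gu Q(2) by (simp add: field_simps power2_eq_square)
    ultimately show ?thesis by (simp add: sign Q_def)
  qed
  show "(\<beta> has_vector_derivative Complex (\<eta> * b\<^sup>2 / (2 * Q u * (g u)\<^sup>2)) (\<eta> * b * P u / (2 * Q u * (g u)\<^sup>2))) (at u)"
    unfolding \<beta>_def
  proof (rule has_vector_derivative_Complex)
    have "((\<lambda>u. L u - P u * Q u) has_real_derivative
        Q u * g u - ((g u - \<eta> / 2) * Q u + \<eta> * P u / (2 * Q u * (g u)\<^sup>2) * P u)) (at u)"
      by (intro DERIV_diff DERIV_mult D DQ)
    moreover have "Q u * g u - ((g u - \<eta> / 2) * Q u + \<eta> * P u / (2 * Q u * (g u)\<^sup>2) * P u)
       = \<eta> * ((Q u)\<^sup>2 * (g u)\<^sup>2 - (P u)\<^sup>2) / (2 * Q u * (g u)\<^sup>2)"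
      using gu Q(2) by (simp add: field_simps power2_eq_square)
    ultimately show "((\<lambda>u. L u - P u * Q u) has_real_derivative \<eta> * b\<^sup>2 / (2 * Q u * (g u)\<^sup>2)) (at u)"
      unfolding bP[symmetric] by simp
    show "((\<lambda>u. b * Q u) has_real_derivative \<eta> * b * P u / (2 * Q u * (g u)\<^sup>2)) (at u)"
      using DERIV_cmult[OF DQ, of b] by (simp add: mult_ac)
  qed
  have "(norm (Complex (\<eta> * b\<^sup>2 / (2 * Q u * (g u)\<^sup>2)) (\<eta> * b * P u / (2 * Q u * (g u)\<^sup>2))))\<^sup>2
      = \<eta>\<^sup>2 * b\<^sup>2 * (b\<^sup>2 + (P u)\<^sup>2) / (2 * Q u * (g u)\<^sup>2)\<^sup>2"
    unfolding cmod_power2 by (simp add: power_divide power_mult_distrib add_divide_distrib[symmetric])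
      (simp add: algebra_simps power2_eq_square power4_eq_xxxx)
  also have "\<dots> = (v u)\<^sup>2"
    unfolding bP sign v_def using gu Q(2) by (simp add: field_simps power2_eq_square)
  finally show "norm (Complex (\<eta> * b\<^sup>2 / (2 * Q u * (g u)\<^sup>2)) (\<eta> * b * P u / (2 * Q u * (g u)\<^sup>2))) = v u"
    by (rule power2_eq_imp_eq) (use fb gu in \<open>simp_all add: v_def\<close>)
  have "(Im (\<beta> u))\<^sup>2 = b\<^sup>2 * (Q u)\<^sup>2" by (simp add: \<beta>_def power_mult_distrib)
  also have "\<dots> = \<epsilon>\<^sup>2 * ((f\<^sup>2 - 1/4) * (1 - \<eta> / g u))"
    unfolding fb(3) Q by (simp add: power2_eq_square mult_ac)
  also have "\<dots> = f * ((f\<^sup>2 + 1/4) / f - C u)"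
    unfolding sign C_def using fb(1) gu by (simp add: field_simps power2_eq_square)
  finally show "(Im (\<beta> u))\<^sup>2 = f * ((f\<^sup>2 + 1/4) / f - C u)" .
  show "(C has_real_derivative - (2 * v u) * S u) (at u)"
  proof -
    have "(C has_real_derivative - (\<eta> * (f\<^sup>2 - 1/4)) * (\<epsilon> * P u) / (g u)\<^sup>2 / f) (at u)"
      unfolding C_def
      by (rule derivative_eq_intros D refl | use gu fb(1) in \<open>simp add: power2_eq_square\<close>)+
    moreover have "- (\<eta> * (f\<^sup>2 - 1/4)) * (\<epsilon> * P u) / (g u)\<^sup>2 / f = - (\<eta> * b\<^sup>2 * P u / (f * (g u)\<^sup>2))"
      unfolding fb(3) using gu fb(1) by (simp add: field_simps)
    moreover have "\<dots> = - (2 * v u) * S u"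
      unfolding v_def S_def using gu fb(1) by (simp add: field_simps power2_eq_square)
    ultimately show ?thesis by simp
  qed
  show "(S has_real_derivative (2 * v u) * C u) (at u)"
  proof -
    have "(S has_real_derivative (\<eta> * b * (g u - \<eta> / 2) * (f * g u) - \<eta> * b * P u * (f * (\<epsilon> * P u))) /
        (f * g u * (f * g u))) (at u)"
      unfolding S_def
      by (intro DERIV_divide DERIV_cmult D) (use gu fb(1) in simp)
    moreover have "\<eta> * b * (g u - \<eta> / 2) * (f * g u) - \<eta> * b * P u * (f * (\<epsilon> * P u)) =
        b * f * (g u / 2 + \<eta> * (f\<^sup>2 - 1/4))"
    proof -
      have eP: "\<epsilon> * (P u)\<^sup>2 = \<epsilon>\<^sup>2 * ((g u - \<eta> / 2)\<^sup>2 - f\<^sup>2)"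
        unfolding P by (simp add: power2_eq_square)
      have "\<eta> * b * (g u - \<eta> / 2) * (f * g u) - \<eta> * b * P u * (f * (\<epsilon> * P u)) =
          \<eta> * b * f * ((g u - \<eta> / 2) * g u - \<epsilon> * (P u)\<^sup>2)"
        by (simp add: algebra_simps power2_eq_square)
      also have "\<dots> = b * f * (\<eta>\<^sup>2 * g u / 2 + \<eta> * (f\<^sup>2 - \<eta>\<^sup>2 / 4))"
        unfolding eP sign(1) by (simp add: algebra_simps power2_eq_square)
      finally show ?thesis by (simp add: sign(2))
    qed
    moreover have "b * f * (g u / 2 + \<eta> * (f\<^sup>2 - 1/4)) / (f * g u * (f * g u)) = (2 * v u) * C u"
      unfolding v_def C_def using gu fb(1) by (simp add: field_simps)
    ultimately show ?thesis by simp
  qed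
  show "(C u)\<^sup>2 + (S u)\<^sup>2 = 1"
  proof -
    have "(C u)\<^sup>2 + (S u)\<^sup>2 = ((g u / 2 + \<eta> * (f\<^sup>2 - 1/4))\<^sup>2 + \<eta>\<^sup>2 * b\<^sup>2 * (P u)\<^sup>2) / (f * g u)\<^sup>2"
      unfolding C_def S_def using gu fb(1) by (simp add: field_simps power2_eq_square)
    also have "\<eta>\<^sup>2 * b\<^sup>2 * (P u)\<^sup>2 = \<epsilon>\<^sup>2 * ((f\<^sup>2 - 1/4) * ((g u - \<eta> / 2)\<^sup>2 - f\<^sup>2))"
      unfolding fb(3) P sign(2) by (simp add: power2_eq_square)
    also have "(g u / 2 + \<eta> * (f\<^sup>2 - 1/4))\<^sup>2 + \<dots> =
        (f * g u)\<^sup>2 + (\<eta>\<^sup>2 - 1) * ((f\<^sup>2 - 1/4)\<^sup>2 + (f\<^sup>2 - 1/4) / 4)"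
      unfolding sign(1) by (simp add: field_simps power2_eq_square)
    also have "\<dots> = (f * g u)\<^sup>2" by (simp add: sign(2))
    finally show ?thesis using gu fb(1) by simp
  qed
qed

section \<open>Unduloids\<close>

lemma focal_properties:
  assumes "- 1/4 < M" "M \<noteq> 0"
  shows "focal M > 0" "(focal M)\<^sup>2 - 1/4 = M" "((focal M)\<^sup>2 + 1/4) / focal M > 1"
proof -
  show f: "focal M > 0" "(focal M)\<^sup>2 - 1/4 = M" using assms by (simp_all add: focal_def)
  have "focal M \<noteq> 1/2"
  proof
    assume h: "focal M = 1/2"
    show False using f(2) assms(2) unfolding h by (simp add: power_divide)
  qed
  then have "(focal M - 1/2)\<^sup>2 > 0" by simp
  then show "((focal M)\<^sup>2 + 1/4) / focal M > 1"
    using f(1) by (simp add: field_simps power2_eq_square)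
qed

lemma focal_gt_half: "0 < M \<Longrightarrow> 1/2 < focal M"
  unfolding focal_def by (rule real_less_rsqrt) (simp add: power_divide)

lemma unduloid_profile_eq:
  assumes M: "- 1/4 < M" "M < 0"
  defines "f \<equiv> focal M" and "g \<equiv> \<lambda>u. focal M * cos u + 1/2"
  defines "Q \<equiv> \<lambda>u. sqrt (-1 * (1 - 1 / g u))"
  shows "0 < g u" "0 < -1 * (1 - 1 / g u)"
    and "(arclen (ellipse M) has_real_derivative Q u * g u) (at u)"
    and "unduloid_profile M = (\<lambda>u. Complex (arclen (ellipse M) u - f * sin u * Q u) (sqrt (- M) * Q u))"
proof -
  have f: "0 < f" "f\<^sup>2 = 1/4 + M" using focal_properties[of M] M by (simp_all add: f_def)
  have f_half: "f < 1/2" by (rule power2_less_imp_less) (use f M in \<open>simp_all add: power2_eq_square\<close>)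
  have fc: "\<bar>f * cos u\<bar> < 1/2" for u
  proof -
    have "\<bar>f * cos u\<bar> \<le> f * 1" unfolding abs_mult using f(1) by (intro mult_mono) auto
    then show ?thesis using f_half by simp
  qed
  then have g: "0 < g u" "g u < 1" for u
    unfolding g_def f_def[symmetric] using abs_less_iff[of "f * cos u" "1/2"] fc[of u] by linarith+
  show "0 < g u" by (rule g)
  have g': "0 < -1 * (1 - 1 / g u)" for u using g[of u] by (simp add: field_simps)
  then show "0 < -1 * (1 - 1 / g u)" .
  let ?\<gamma>' = "\<lambda>u. Complex (- sin u / 2) (sqrt (- M) * cos u)"
  have D: "(ellipse M has_vector_derivative ?\<gamma>' u) (at u)" for u
    unfolding ellipse_def[abs_def]
    by (rule has_vector_derivative_Complex; (rule derivative_eq_intros refl | simp)+)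
  have norm: "norm (?\<gamma>' u) = Q u * g u" for u
  proof -
    have "(norm (?\<gamma>' u))\<^sup>2 = (sin u)\<^sup>2 / 4 - M * (cos u)\<^sup>2"
      unfolding cmod_power2 using M by (simp add: power_mult_distrib power_divide)
    also have "\<dots> = 1/4 - f\<^sup>2 * (cos u)\<^sup>2"
      using sin_cos_squared_add[of u] f(2) by algebra
    also have "\<dots> = (g u - (g u)\<^sup>2)"
      by (simp add: g_def f_def algebra_simps power2_eq_square)
    also have "\<dots> = (Q u * g u)\<^sup>2"
      using g'[of u] g[of u] by (simp add: Q_def power_mult_distrib) (simp add: field_simps power2_eq_square)
    finally show ?thesis
      by (rule power2_eq_imp_eq) (use g'[of u] g[of u] in \<open>simp_all add: Q_def\<close>)
  qed
  have "continuous_on UNIV (\<lambda>u. norm (?\<gamma>' u))"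
    unfolding complex_norm by (intro continuous_intros) simp
  from arclen_DERIV[OF D this]
  show "(arclen (ellipse M) has_real_derivative Q u * g u) (at u)" by (simp only: norm)
  show "unduloid_profile M = (\<lambda>u. Complex (arclen (ellipse M) u - f * sin u * Q u) (sqrt (- M) * Q u))"
  proof
    fix u
    have QQ: "Q u * (Q u * g u) = 1 - g u"
    proof -
      have "Q u * Q u = -1 * (1 - 1 / g u)"
        unfolding Q_def using g'[of u] by (intro real_sqrt_mult_self[THEN trans] abs_of_pos)
      then have "(Q u * Q u) * g u = 1 - g u" using g[of u] by (simp add: field_simps)
      then show ?thesis by (simp add: mult.assoc)
    qed
    have Q0: "Q u * g u \<noteq> 0" "Q u \<noteq> 0" using g[of u] g'[of u] by (simp_all add: Q_def)
    have "Re (of_real f - ellipse M u) * (- sin u / 2) + Im (of_real f - ellipse M u) * (sqrt (- M) * cos u)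
        = - f * sin u / 2 + (1/4 + M) * (sin u * cos u)"
      using M by (simp add: ellipse_def algebra_simps)
    also have "\<dots> = - f * sin u * (1 - g u)"
      unfolding f(2)[symmetric] by (simp add: g_def f_def[symmetric] algebra_simps power2_eq_square)
    finally have re: "Re (of_real f - ellipse M u) * (- sin u / 2) +
        Im (of_real f - ellipse M u) * (sqrt (- M) * cos u) = - f * sin u * (1 - g u)" .
    have im: "Im (of_real f - ellipse M u) * (- sin u / 2) - Re (of_real f - ellipse M u) * (sqrt (- M) * cos u)
        = sqrt (- M) * (1 - g u)"
    proof -
      have "Im (of_real f - ellipse M u) * (- sin u / 2) - Re (of_real f - ellipse M u) * (sqrt (- M) * cos u)
        = sqrt (- M) * (((sin u)\<^sup>2 + (cos u)\<^sup>2) / 2 - f * cos u)"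
        by (simp add: ellipse_def algebra_simps power2_eq_square
            del: sin_cos_squared_add sin_cos_squared_add2 sin_cos_squared_add3)
      then show ?thesis by (simp add: g_def f_def)
    qed
    show "unduloid_profile M u = Complex (arclen (ellipse M) u - f * sin u * Q u) (sqrt (- M) * Q u)"
      unfolding unduloid_profile_def f_def[symmetric] roll_eq[OF D] norm complex.sel re im
      unfolding QQ[symmetric] using Q0 by simp
  qed
qed

text \<open>The parametrization by the angle \<open>u\<close> of the ellipse is not by arc length; the speed
  \<open>b / (2 g)\<close> is at least \<open>b / (2 (f + 1/2))\<close>, hence the profile is complete.\<close>
lemma unduloid_pulls_back_model:
  assumes M: "- 1/4 < M" "M < 0"
  shows "pulls_back_model (((focal M)\<^sup>2 + 1/4) / focal M) (revolution (unduloid_profile M))"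
proof -
  define f where "f = focal M"
  define b where "b = sqrt (- M)"
  define g where "g = (\<lambda>u. f * cos u + 1/2)"
  have f: "0 < f" "f\<^sup>2 - 1/4 = M" "(f\<^sup>2 + 1/4) / f > 1"
    using focal_properties[of M] M by (simp_all add: f_def)
  have b: "0 < b" "b\<^sup>2 = -1 * (f\<^sup>2 - 1/4)" using M f by (simp_all add: b_def)
  note eq = unduloid_profile_eq[OF M, folded f_def b_def]
  have g: "0 < g u" "0 < -1 * (1 - 1 / g u)" for u
    unfolding g_def by (rule eq(1), rule eq(2))
  have DL: "(arclen (ellipse M) has_real_derivative sqrt (-1 * (1 - 1 / g u)) * g u) (at u)" for u
    unfolding g_def by (rule eq(3))
  have g_le: "g u \<le> f + 1/2" for u using f(1) by (simp add: g_def mult_left_le)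
  have DP: "((\<lambda>u. f * sin u) has_real_derivative g u - 1 / 2) (at u)" for u
    by (rule derivative_eq_intros refl | simp add: g_def)+
  have Dg: "(g has_real_derivative -1 * (f * sin u)) (at u)" for u
    unfolding g_def by (rule derivative_eq_intros refl | simp)+
  have P: "(f * sin u)\<^sup>2 = -1 * ((g u - 1 / 2)\<^sup>2 - f\<^sup>2)" for u
  proof -
    have "(f * sin u)\<^sup>2 + (f * cos u)\<^sup>2 = f\<^sup>2"
      by (simp add: power_mult_distrib distrib_left[symmetric])
    then show ?thesis by (simp add: g_def)
  qed
  have sign: "(-1 :: real)\<^sup>2 = 1" "(1 :: real)\<^sup>2 = 1" by simp_all
  note R = conic_roulette[OF sign f(1) b g P DP Dg DL]
  have D: "\<exists>\<delta>'. (unduloid_profile M has_vector_derivative \<delta>') (at u) \<and> norm \<delta>' = b / (2 * g u)" for u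
    unfolding eq(4) using R(1,2) unfolding g_def by blast
  have Y: "(Im (unduloid_profile M u))\<^sup>2 = f * ((f\<^sup>2 + 1/4) / f - (1/2 + 1 * (f\<^sup>2 - 1/4) / g u) / f)" for u
    unfolding eq(4) using R(3) unfolding g_def by blast
  have metric: "induced_metric (revolution (unduloid_profile M)) (s, t) (a1, a2) (b1, b2) =
      (b / (2 * g s))\<^sup>2 * (a1 * b1) + 0 * (a1 * b2 + a2 * b1) +
      (f * ((f\<^sup>2 + 1/4) / f - (1/2 + 1 * (f\<^sup>2 - 1/4) / g s) / f)) * (a2 * b2)" for s t a1 a2 b1 b2
    using D[of s] induced_metric_revolution[of "unduloid_profile M" _ s t a1 a2 b1 b2] unfolding Y by auto
  have smg: "smooth g" unfolding g_def by (intro smooth_intros)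
  show ?thesis
    unfolding f_def[symmetric]
  proof (rule pulls_back_modelI[OF metric _ _ _ _ _ _ refl f(1) f(3) R(4-6)])
    show "smooth (\<lambda>s. f * ((f\<^sup>2 + 1/4) / f - (1/2 + 1 * (f\<^sup>2 - 1/4) / g s) / f))"
      "smooth (\<lambda>s. b / (2 * g s))"
      using f(1) g(1) by (intro smooth_intros smooth_divide smg; simp add: order_less_imp_not_eq2)+
    show "b / (2 * (f + 1/2)) \<le> b / (2 * g s)" for s
      using b(1) f(1) g(1)[of s] g_le[of s] by (intro divide_left_mono mult_pos_pos) auto
  qed (use b(1) f(1) in \<open>simp_all add: smooth_const add_pos_pos\<close>)
qed

section \<open>The two arcs of a nodoid\<close>

text \<open>The distance from the contact point to the focus that does not trace the arc with sign
  \<open>\<eta>\<close>.\<close>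
definition nodoid_denominator :: "real \<Rightarrow> real \<Rightarrow> real \<Rightarrow> real" where
  "nodoid_denominator M \<eta> u = focal M * cosh u + \<eta> / 2"

text \<open>The common form of the two focal traces, both placed above the line.  The factor 1 is
  the sign \<open>\<epsilon>\<close> of the hyperbola.\<close>
definition nodoid_arc :: "real \<Rightarrow> real \<Rightarrow> real \<Rightarrow> complex" where
  "nodoid_arc M \<eta> u =
     Complex (arclen (hyperbola_branch M) u -
         focal M * sinh u * sqrt (1 * (1 - \<eta> / nodoid_denominator M \<eta> u)))
       (sqrt M * sqrt (1 * (1 - \<eta> / nodoid_denominator M \<eta> u)))"

lemma hyperbola_roll:
  assumes M: "M > 0" and \<eta>: "\<eta> = 1 \<or> \<eta> = -1"
  defines "f \<equiv> focal M" and "g \<equiv> nodoid_denominator M \<eta>"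
  defines "Q \<equiv> \<lambda>u. sqrt (1 * (1 - \<eta> / g u))"
  shows "0 < g u" "0 < 1 * (1 - \<eta> / g u)"
    and "(arclen (hyperbola_branch M) has_real_derivative Q u * g u) (at u)"
    and "roll (hyperbola_branch M) (of_real (\<eta> * f)) u =
      Complex (arclen (hyperbola_branch M) u - f * sinh u * Q u) (- \<eta> * (sqrt M * Q u))"
proof -
  have f: "0 < f" "f\<^sup>2 = 1/4 + M" using focal_properties[of M] M by (simp_all add: f_def)
  have f_half: "1/2 < f" using focal_gt_half[OF M] by (simp add: f_def)
  have fc: "1/2 < f * cosh u" for u
  proof -
    have "f * 1 \<le> f * cosh u" using f(1) cosh_real_ge_1 by (intro mult_left_mono) auto
    then show ?thesis using f_half by linarith
  qed
  have geq: "g u = f * cosh u + \<eta> / 2" for u by (simp add: g_def f_def nodoid_denominator_def)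
  have g: "0 < g u" "\<eta> < g u" for u using fc[of u] \<eta> by (auto simp: geq)
  show "0 < g u" by (rule g)
  have g': "0 < 1 * (1 - \<eta> / g u)" for u using g[of u] by (simp add: field_simps)
  then show "0 < 1 * (1 - \<eta> / g u)" .
  have \<eta>2: "\<eta>\<^sup>2 = 1" using \<eta> by auto
  let ?\<gamma>' = "\<lambda>u. Complex (sinh u / 2) (sqrt M * cosh u)"
  have D: "(hyperbola_branch M has_vector_derivative ?\<gamma>' u) (at u)" for u
    unfolding hyperbola_branch_def[abs_def]
    by (rule has_vector_derivative_Complex; (rule derivative_eq_intros refl | simp)+)
  have norm: "norm (?\<gamma>' u) = Q u * g u" for u
  proof -
    have "(norm (?\<gamma>' u))\<^sup>2 = (sinh u)\<^sup>2 / 4 + M * (cosh u)\<^sup>2"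
      unfolding cmod_power2 using M by (simp add: power_mult_distrib power_divide)
    also have "\<dots> = f\<^sup>2 * (cosh u)\<^sup>2 - 1/4"
      using cosh_square_eq[of u] f(2) by algebra
    also have "\<dots> = (g u)\<^sup>2 - \<eta> * g u - (1 - \<eta>\<^sup>2) / 4"
      by (simp add: geq field_simps power2_eq_square)
    also have "\<dots> = (g u)\<^sup>2 - \<eta> * g u" by (simp add: \<eta>2)
    also have "\<dots> = (Q u * g u)\<^sup>2"
      using g'[of u] g[of u] by (simp add: Q_def power_mult_distrib) (simp add: field_simps power2_eq_square)
    finally show ?thesis
      by (rule power2_eq_imp_eq) (use g'[of u] g[of u] in \<open>simp_all add: Q_def\<close>)
  qed
  have "continuous_on UNIV (\<lambda>u. norm (?\<gamma>' u))"
    unfolding complex_norm by (intro continuous_intros) simp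
  from arclen_DERIV[OF D this]
  show "(arclen (hyperbola_branch M) has_real_derivative Q u * g u) (at u)" by (simp only: norm)
  have QQ: "Q u * (Q u * g u) = g u - \<eta>"
  proof -
    have "Q u * Q u = 1 * (1 - \<eta> / g u)"
      unfolding Q_def using g'[of u] by (intro real_sqrt_mult_self[THEN trans] abs_of_pos)
    then have "(Q u * Q u) * g u = g u - \<eta>" using g[of u] by (simp add: field_simps)
    then show ?thesis by (simp add: mult.assoc)
  qed
  have Q0: "Q u * g u \<noteq> 0" "Q u \<noteq> 0" using g[of u] g'[of u] by (simp_all add: Q_def)
  have "Re (of_real (\<eta> * f) - hyperbola_branch M u) * (sinh u / 2) +
      Im (of_real (\<eta> * f) - hyperbola_branch M u) * (sqrt M * cosh u)
      = \<eta> * f * sinh u / 2 - (1/4 + M) * (sinh u * cosh u)"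
    using M by (simp add: hyperbola_branch_def algebra_simps)
  also have "\<dots> = - (f * sinh u * (g u - \<eta>))"
    unfolding f(2)[symmetric] by (simp add: geq algebra_simps power2_eq_square)
  finally have re: "Re (of_real (\<eta> * f) - hyperbola_branch M u) * (sinh u / 2) +
      Im (of_real (\<eta> * f) - hyperbola_branch M u) * (sqrt M * cosh u) = - (f * sinh u * (g u - \<eta>))" .
  have "Im (of_real (\<eta> * f) - hyperbola_branch M u) * (sinh u / 2) -
      Re (of_real (\<eta> * f) - hyperbola_branch M u) * (sqrt M * cosh u)
      = sqrt M * (((cosh u)\<^sup>2 - (sinh u)\<^sup>2) / 2 - \<eta> * f * cosh u)"
    by (simp add: hyperbola_branch_def algebra_simps power2_eq_square)
  also have "(cosh u)\<^sup>2 - (sinh u)\<^sup>2 = 1" by (simp add: cosh_square_eq)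
  also have "sqrt M * (1 / 2 - \<eta> * f * cosh u) = - \<eta> * (sqrt M * (g u - \<eta>)) + sqrt M * (1 - \<eta>\<^sup>2) / 2"
    by (simp add: geq field_simps power2_eq_square)
  finally have im: "Im (of_real (\<eta> * f) - hyperbola_branch M u) * (sinh u / 2) -
      Re (of_real (\<eta> * f) - hyperbola_branch M u) * (sqrt M * cosh u) = - \<eta> * (sqrt M * (g u - \<eta>))"
    by (simp add: \<eta>2)
  show "roll (hyperbola_branch M) (of_real (\<eta> * f)) u =
      Complex (arclen (hyperbola_branch M) u - f * sinh u * Q u) (- \<eta> * (sqrt M * Q u))"
    unfolding roll_eq[OF D] norm complex.sel re im
    unfolding QQ[symmetric] using Q0 by simp
qed

lemma nodoid_arcs_eq:
  assumes "M > 0"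
  shows "nodoid_lower_arc M = nodoid_arc M 1" "nodoid_upper_arc M = nodoid_arc M (-1)"
  using hyperbola_roll(4)[OF assms, of 1] hyperbola_roll(4)[OF assms, of "-1"]
  by (simp_all add: fun_eq_iff nodoid_lower_arc_def nodoid_upper_arc_def nodoid_arc_def complex_eq_iff)

text \<open>The horizontal velocity has the sign of \<open>\<eta>\<close>: the nodoid moves forward along the lower arcs and backward
  along the upper ones.\<close>
lemma nodoid_arc_geometry:
  assumes M: "M > 0" and \<eta>: "\<eta> = 1 \<or> \<eta> = -1"
  defines "f \<equiv> focal M" and "b \<equiv> sqrt M" and "g \<equiv> nodoid_denominator M \<eta>"
  defines "C \<equiv> \<lambda>u. (1/2 + \<eta> * (f\<^sup>2 - 1/4) / g u) / f" and "S \<equiv> \<lambda>u. \<eta> * b * (f * sinh u) / (f * g u)"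
  shows "\<exists>\<beta>'. (nodoid_arc M \<eta> has_vector_derivative \<beta>') (at u) \<and> norm \<beta>' = b / (2 * g u) \<and>
      Re \<beta>' = \<eta> * b ^ 3 / (2 * Im (nodoid_arc M \<eta> u) * (g u)\<^sup>2)"
    and "(Im (nodoid_arc M \<eta> u))\<^sup>2 = f * ((f\<^sup>2 + 1/4) / f - C u)" "Im (nodoid_arc M \<eta> u) > 0"
    and "(C has_real_derivative - (2 * (b / (2 * g u))) * S u) (at u)"
    and "(S has_real_derivative (2 * (b / (2 * g u))) * C u) (at u)"
    and "(C u)\<^sup>2 + (S u)\<^sup>2 = 1"
proof -
  have f: "f > 0" "b > 0" "b\<^sup>2 = 1 * (f\<^sup>2 - 1/4)" "b\<^sup>2 = M"
    using focal_properties[of M] M by (simp_all add: f_def b_def)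
  have sign: "(1::real)\<^sup>2 = 1" "\<eta>\<^sup>2 = 1" using \<eta> by auto
  note roll = hyperbola_roll[OF M \<eta>, folded g_def]
  have geq: "g u = f * cosh u + \<eta> / 2" for u by (simp add: g_def f_def nodoid_denominator_def)
  have P: "(f * sinh u)\<^sup>2 = 1 * ((g u - \<eta> / 2)\<^sup>2 - f\<^sup>2)" for u
    by (simp add: geq cosh_square_eq power_mult_distrib algebra_simps)
  have DP: "((\<lambda>u. f * sinh u) has_real_derivative g u - \<eta> / 2) (at u)" for u
    by (rule derivative_eq_intros refl | simp add: geq)+
  have Dg: "(g has_real_derivative 1 * (f * sinh u)) (at u)" for u
    unfolding g_def nodoid_denominator_def[abs_def] f_def
    by (rule derivative_eq_intros refl | simp)+
  note R = conic_roulette[OF sign f(1-3) roll(1,2) P DP Dg roll(3)]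
  have arc: "nodoid_arc M \<eta> = (\<lambda>u. Complex (arclen (hyperbola_branch M) u - f * sinh u * sqrt (1 * (1 - \<eta> / g u)))
      (b * sqrt (1 * (1 - \<eta> / g u))))"
    by (simp add: fun_eq_iff nodoid_arc_def f_def b_def g_def)
  show Im_pos: "Im (nodoid_arc M \<eta> u) > 0"
    unfolding arc using f(2) roll(2)[of u] by simp
  let ?\<beta>' = "Complex (\<eta> * b\<^sup>2 / (2 * sqrt (1 * (1 - \<eta> / g u)) * (g u)\<^sup>2))
      (\<eta> * b * (f * sinh u) / (2 * sqrt (1 * (1 - \<eta> / g u)) * (g u)\<^sup>2))"
  show "\<exists>\<beta>'. (nodoid_arc M \<eta> has_vector_derivative \<beta>') (at u) \<and> norm \<beta>' = b / (2 * g u) \<and>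
      Re \<beta>' = \<eta> * b ^ 3 / (2 * Im (nodoid_arc M \<eta> u) * (g u)\<^sup>2)"
  proof (intro exI[of _ ?\<beta>'] conjI)
    show "(nodoid_arc M \<eta> has_vector_derivative ?\<beta>') (at u)" unfolding arc by (rule R(1))
    show "norm ?\<beta>' = b / (2 * g u)" by (rule R(2))
    show "Re ?\<beta>' = \<eta> * b ^ 3 / (2 * Im (nodoid_arc M \<eta> u) * (g u)\<^sup>2)"
      unfolding arc using f(2) by (simp add: power3_eq_cube power2_eq_square)
  qed
  show "(Im (nodoid_arc M \<eta> u))\<^sup>2 = f * ((f\<^sup>2 + 1/4) / f - C u)"
    unfolding arc C_def by (rule R(3))
  show "(C has_real_derivative - (2 * (b / (2 * g u))) * S u) (at u)"
    "(S has_real_derivative (2 * (b / (2 * g u))) * C u) (at u)" "(C u)\<^sup>2 + (S u)\<^sup>2 = 1"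
    unfolding C_def S_def by (rule R)+
qed

section \<open>The metric of a nodoid\<close>

text \<open>Unit speed forces the parameter change to have derivative \<open>2 g / b\<close>, the inverse of the speed of the arc.
  In the new parameter the squared height is a harmonic oscillator about \<open>f\<^sup>2 + 1/4\<close>; its
  frequency and energy do not depend on the arc.\<close>
lemma unit_speed_along_arc_oscillates:
  assumes M: "M > 0" and \<eta>: "\<eta> = 1 \<or> \<eta> = -1" and "open I"
    and runs: "runs_along \<delta> I (nodoid_arc M \<eta>)"
    and unit: "\<And>s. norm (vector_derivative \<delta> (at s)) = 1" and s: "s \<in> I"
  defines "Y \<equiv> \<lambda>s. (Im (\<delta> s))\<^sup>2" and "m \<equiv> (focal M)\<^sup>2 + 1/4"
  shows "(deriv Y has_real_derivative 4 * (m - Y s)) (at s)"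
    and "(deriv Y s)\<^sup>2 + 4 * (m - Y s)\<^sup>2 = 4 * (focal M)\<^sup>2"
proof -
  define f b g where "f = focal M" and "b = sqrt M" and "g = nodoid_denominator M \<eta>"
  define C S where "C = (\<lambda>u. (1/2 + \<eta> * (f\<^sup>2 - 1/4) / g u) / f)"
    and "S = (\<lambda>u. \<eta> * b * (f * sinh u) / (f * g u))"
  note geo = nodoid_arc_geometry[OF M \<eta>, folded f_def b_def g_def]
  have Y_C: "(Im (nodoid_arc M \<eta> u))\<^sup>2 = f * ((f\<^sup>2 + 1/4) / f - C u)"
    and CS: "(C has_real_derivative - (2 * (b / (2 * g u))) * S u) (at u)"
      "(S has_real_derivative (2 * (b / (2 * g u))) * C u) (at u)" "(C u)\<^sup>2 + (S u)\<^sup>2 = 1" for u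
    unfolding C_def S_def by (rule geo)+
  have f: "f > 0" "b > 0" using focal_properties[of M] M by (simp_all add: f_def b_def)
  have gpos: "g u > 0" for u unfolding g_def by (rule hyperbola_roll(1)[OF M \<eta>])
  obtain h d where h: "\<And>s. s \<in> I \<Longrightarrow> \<exists>h'>0. (h has_real_derivative h') (at s)"
    and \<delta>: "\<And>s. s \<in> I \<Longrightarrow> \<delta> s = nodoid_arc M \<eta> (h s) + of_real d"
    using runs unfolding runs_along_def by blast
  have Dh: "(h has_real_derivative 2 * g (h s) / b) (at s)" if "s \<in> I" for s
  proof -
    obtain h' where h': "h' > 0" "(h has_real_derivative h') (at s)" using h[OF \<open>s \<in> I\<close>] by blast
    obtain \<beta>' where \<beta>': "(nodoid_arc M \<eta> has_vector_derivative \<beta>') (at (h s))"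
      "norm \<beta>' = b / (2 * g (h s))"
      using geo(1) by blast
    have "((\<lambda>s. nodoid_arc M \<eta> (h s) + of_real d) has_vector_derivative h' *\<^sub>R \<beta>') (at s)"
      using vector_diff_chain_at[OF h'(2)[unfolded has_real_derivative_iff_has_vector_derivative] \<beta>'(1)]
      by (simp add: o_def has_vector_derivative_add_const)
    then have "(\<delta> has_vector_derivative h' *\<^sub>R \<beta>') (at s)"
      by (rule has_vector_derivative_transform_within_open[OF _ \<open>open I\<close> \<open>s \<in> I\<close>]) (simp add: \<delta>)
    then have "h' * norm \<beta>' = 1"
      using unit[of s] h'(1) by (simp add: vector_derivative_at)
    then have "h' = 2 * g (h s) / b" unfolding \<beta>'(2) using f(2) gpos[of "h s"] by (simp add: field_simps)
    then show ?thesis using h'(2) by simp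
  qed
  have DC: "((\<lambda>s. C (h s)) has_real_derivative - 2 * S (h s)) (at s)"
    and DS: "((\<lambda>s. S (h s)) has_real_derivative 2 * C (h s)) (at s)" if "s \<in> I" for s
  proof -
    have eq: "- (2 * (b / (2 * g (h s)))) * x * (2 * g (h s) / b) = -2 * x"
      "2 * (b / (2 * g (h s))) * x * (2 * g (h s) / b) = 2 * x" for x
      using gpos[of "h s"] f by (simp_all add: field_simps)
    show "((\<lambda>s. C (h s)) has_real_derivative - 2 * S (h s)) (at s)"
      by (rule DERIV_chain2[OF CS(1) Dh[OF that], unfolded eq])
    show "((\<lambda>s. S (h s)) has_real_derivative 2 * C (h s)) (at s)"
      by (rule DERIV_chain2[OF CS(2) Dh[OF that], unfolded eq])
  qed
  have Y: "Y s = f * (m / f - C (h s))" if "s \<in> I" for s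
    using Y_C[of "h s"] by (simp add: Y_def \<delta>[OF that] m_def f_def)
  have DY: "deriv Y s = 2 * f * S (h s)" if "s \<in> I" for s
  proof -
    have "((\<lambda>s. f * (m / f - C (h s))) has_real_derivative f * (0 - - 2 * S (h s))) (at s)"
      by (intro DERIV_cmult DERIV_diff DERIV_const DC that)
    then have "(Y has_real_derivative f * (0 - - 2 * S (h s))) (at s)"
      by (rule has_field_derivative_transform_within_open[OF _ \<open>open I\<close> that]) (simp add: Y)
    then show ?thesis by (simp add: DERIV_imp_deriv)
  qed
  have mY: "m - Y s = f * C (h s)" using f by (simp add: Y[OF s] algebra_simps)
  have "((\<lambda>s. 2 * f * S (h s)) has_real_derivative 2 * f * (2 * C (h s))) (at s)"
    by (intro DERIV_cmult DS s)
  then have "(deriv Y has_real_derivative 2 * f * (2 * C (h s))) (at s)"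
    by (rule has_field_derivative_transform_within_open[OF _ \<open>open I\<close> s]) (simp add: DY)
  then show "(deriv Y has_real_derivative 4 * (m - Y s)) (at s)"
    by (simp add: mY)
  have "(deriv Y s)\<^sup>2 + 4 * (m - Y s)\<^sup>2 = 4 * f\<^sup>2 * ((C (h s))\<^sup>2 + (S (h s))\<^sup>2)"
    unfolding mY DY[OF s] by (simp add: power_mult_distrib algebra_simps)
  then show "(deriv Y s)\<^sup>2 + 4 * (m - Y s)\<^sup>2 = 4 * (focal M)\<^sup>2"
    by (simp add: CS(3) f_def)
qed

text \<open>Used to carry differential equations from the open arcs over the joints, where nothing but smoothness
  is known.\<close>
lemma periodic_zero_off_joints:
  fixes F :: "real \<Rightarrow> real"
  assumes cont: "continuous_on UNIV F" and per: "\<And>s. F (s + (p + q)) = F s" and "0 < p" "0 < q"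
    and zero: "\<And>s. s \<in> {0<..<p} \<Longrightarrow> F s = 0" "\<And>s. s \<in> {p<..<p + q} \<Longrightarrow> F s = 0"
  shows "F s = 0"
proof -
  have 1: "F s = 0" if "s \<in> {a..b}" "a < b" "\<And>s. s \<in> {a<..<b} \<Longrightarrow> F s = 0" for a b s
    using continuous_constant_on_closure[of "{a<..<b}" F 0 s] that
      continuous_on_subset[OF cont subset_UNIV]
    by (simp add: closure_greaterThanLessThan)
  have 2: "F s = 0" if "s \<in> {0..p + q}" for s
    using 1[of s 0 p] 1[of s p "p + q"] zero that \<open>0 < p\<close> \<open>0 < q\<close> by (cases "s \<le> p") auto
  have nat: "F (s + real n * (p + q)) = F s" for s n
  proof (induction n)
    case (Suc n)
    have "s + real (Suc n) * (p + q) = (s + real n * (p + q)) + (p + q)" by (simp add: algebra_simps)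
    then show ?case using per Suc by metis
  qed simp
  have int: "F (s + of_int k * (p + q)) = F s" for s k
  proof (cases k rule: int_cases2)
    case (nonneg n)
    then show ?thesis using nat by simp
  next
    case (nonpos n)
    then show ?thesis using nat[of "s + of_int k * (p + q)" n] by simp
  qed
  define k where "k = \<lfloor>s / (p + q)\<rfloor>"
  have "of_int k * (p + q) \<le> s" "s < (of_int k + 1) * (p + q)"
    using floor_divide_lower[of "p + q" s] floor_divide_upper[of "p + q" s] \<open>0 < p\<close> \<open>0 < q\<close>
    by (simp_all add: k_def)
  then have "F (s - of_int k * (p + q)) = 0" by (intro 2) (auto simp: algebra_simps)
  then show ?thesis using int[of "s - of_int k * (p + q)" k] by simp
qed

lemma nodoid_pulls_back_model:
  assumes M: "M > 0" and "nodoid_profile M \<delta>"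
  shows "pulls_back_model (((focal M)\<^sup>2 + 1/4) / focal M) (revolution \<delta>)"
proof -
  define f where "f = focal M"
  define Y where "Y = (\<lambda>s. (Im (\<delta> s))\<^sup>2)"
  have f: "f > 0" "(f\<^sup>2 + 1/4) / f > 1" using focal_properties[of M] M by (simp_all add: f_def)
  obtain p q P where \<delta>: "smooth \<delta>" and unit: "\<And>s. norm (vector_derivative \<delta> (at s)) = 1"
    and pq: "p > 0" "q > 0"
    and runs: "runs_along \<delta> {0<..<p} (nodoid_arc M 1)" "runs_along \<delta> {p<..<p + q} (nodoid_arc M (-1))"
    and per: "\<And>s. \<delta> (s + (p + q)) = \<delta> s + of_real P"
    using assms unfolding nodoid_profile_def nodoid_arcs_eq[OF M] by blast
  have smY: "smooth Y"
    unfolding Y_def by (intro smooth_power smooth_linear_image[OF bounded_linear_Im] \<delta>)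
  note smY' = smooth_deriv[OF smY] and smY'' = smooth_deriv[OF smooth_deriv[OF smY]]
  have perY: "Y (s + (p + q)) = Y s" for s by (simp add: Y_def per)
  have per_deriv: "deriv F (s + (p + q)) = deriv F s"
    if "smooth F" "\<And>s. F (s + (p + q)) = F s" for F :: "real \<Rightarrow> real" and s
  proof -
    have "((\<lambda>s. F (s + (p + q))) has_real_derivative deriv F (s + (p + q))) (at s)"
      using smooth_DERIV[OF that(1), of "s + (p + q)"] by (simp add: DERIV_shift)
    then show ?thesis by (simp add: that(2) DERIV_imp_deriv)
  qed
  note perY' = per_deriv[OF smY perY] and perY'' = per_deriv[OF smY' per_deriv[OF smY perY]]
  note arc1 = unit_speed_along_arc_oscillates[OF M disjI1[OF refl] open_greaterThanLessThan runs(1) unit,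
      folded Y_def f_def]
  note arc2 = unit_speed_along_arc_oscillates[OF M disjI2[OF refl] open_greaterThanLessThan runs(2) unit,
      folded Y_def f_def]
  have Y: "(Im (\<delta> s))\<^sup>2 = Y s" for s by (simp add: Y_def)
  have cont: "continuous_on UNIV F" if "smooth F" for F :: "real \<Rightarrow> real"
    using that Ck_continuous by (auto simp: smooth_def)
  have "deriv (deriv Y) s - 4 * (f\<^sup>2 + 1/4 - Y s) = 0" for s
    by (rule periodic_zero_off_joints[where F = "\<lambda>s. deriv (deriv Y) s - 4 * (f\<^sup>2 + 1/4 - Y s)", OF _ _ pq])
      (auto intro!: cont smooth_intros smY smY'' simp: Y perY perY'' DERIV_imp_deriv[OF arc1(1)]
        DERIV_imp_deriv[OF arc2(1)])
  then have Y'': "deriv (deriv Y) s = 4 * (f\<^sup>2 + 1/4 - Y s)" for s by simp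
  have "(deriv Y s)\<^sup>2 + 4 * (f\<^sup>2 + 1/4 - Y s)\<^sup>2 - 4 * f\<^sup>2 = 0" for s
    by (rule periodic_zero_off_joints[where F = "\<lambda>s. (deriv Y s)\<^sup>2 + 4 * (f\<^sup>2 + 1/4 - Y s)\<^sup>2 - 4 * f\<^sup>2",
          OF _ _ pq])
      (auto intro!: cont smooth_intros smY smY' simp: Y perY perY' arc1(2)[unfolded Y] arc2(2)[unfolded Y])
  then have energy: "(deriv Y s)\<^sup>2 + 4 * (f\<^sup>2 + 1/4 - Y s)\<^sup>2 = 4 * f\<^sup>2" for s by simp
  define C S where "C = (\<lambda>s. (f\<^sup>2 + 1/4 - Y s) / f)" and "S = (\<lambda>s. deriv Y s / (2 * f))"
  have metric: "induced_metric (revolution \<delta>) (s, t) (a1, a2) (b1, b2) =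
      1 * (a1 * b1) + 0 * (a1 * b2 + a2 * b1) + Y s * (a2 * b2)" for s t a1 a2 b1 b2
    using induced_metric_revolution[OF smooth_has_vector_derivative[OF \<delta>], of s t a1 a2 b1 b2]
    by (simp add: unit Y_def)
  show ?thesis
    unfolding f_def[symmetric]
  proof (rule pulls_back_modelI[OF metric smooth_const smY smooth_const])
    show "1 * Y s - 0\<^sup>2 = 1\<^sup>2 * Y s" "(0::real) < 1" "(1::real) \<le> 1" for s by simp_all
    show "Y s = f * ((f\<^sup>2 + 1/4) / f - C s)" for s using f(1) by (simp add: C_def field_simps)
    show "0 < f" "1 < (f\<^sup>2 + 1/4) / f" by (fact f)+
    show "(C has_real_derivative - (2 * 1) * S s) (at s)" for s
    proof -
      have "(C has_real_derivative (0 - deriv Y s) / f) (at s)"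
        unfolding C_def by (intro DERIV_cdivide DERIV_diff DERIV_const smooth_DERIV smY)
      then show ?thesis using f(1) by (simp add: S_def)
    qed
    show "(S has_real_derivative 2 * 1 * C s) (at s)" for s
    proof -
      have "(S has_real_derivative deriv (deriv Y) s / (2 * f)) (at s)"
        unfolding S_def by (intro DERIV_cdivide smooth_DERIV smY')
      moreover have "deriv (deriv Y) s / (2 * f) = 2 * 1 * C s"
        using f(1) by (simp add: C_def Y'' field_simps)
      ultimately show ?thesis by simp
    qed
    show "(C s)\<^sup>2 + (S s)\<^sup>2 = 1" for s
    proof -
      have "(C s)\<^sup>2 + (S s)\<^sup>2 = ((deriv Y s)\<^sup>2 + 4 * (f\<^sup>2 + 1/4 - Y s)\<^sup>2) / (4 * f\<^sup>2)"
        by (simp add: C_def S_def power_divide power_mult_distrib add_divide_distrib)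
      then show ?thesis using f(1) by (simp add: energy)
    qed
  qed
qed

section \<open>Existence of nodoids\<close>

text \<open>On an interval on which \<open>f cos (2 s) - 1/2\<close> has the sign of \<open>\<eta>\<close>, the explicit curve
  follows the arc with the parameter \<open>sinh u = b sin (2 s) / (f cos (2 s) - 1/2)\<close>.  It is found
  by solving \<open>(C, S) = (cos (2 s), sin (2 s))\<close> for \<open>u\<close>, where \<open>(C, S)\<close> is the point of the
  unit circle attached to the arc.  Heights agree by algebra;
  abscissas have equal derivatives, which leaves the translation along the line.\<close>
lemma runs_along_nodoid_arc:
  fixes x y :: "real \<Rightarrow> real"
  assumes M: "M > 0" and \<eta>: "\<eta> = 1 \<or> \<eta> = -1"
  defines "f \<equiv> focal M"
  assumes y: "\<And>s. y s > 0" "\<And>s. (y s)\<^sup>2 = f\<^sup>2 + 1/4 - f * cos (2 * s)"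
    and Dx: "\<And>s. (x has_real_derivative (f * cos (2 * s) - 1/2) / y s) (at s)"
    and "lo < hi" and pos: "\<And>s. s \<in> {lo<..<hi} \<Longrightarrow> \<eta> * (f * cos (2 * s) - 1/2) > 0"
    and onto: "\<And>E. \<eta> * (f * cos E - 1/2) > 0 \<Longrightarrow>
      \<exists>s\<in>{lo<..<hi}. cos (2 * s) = cos E \<and> sin (2 * s) = sin E"
  shows "runs_along (\<lambda>s. Complex (x s) (y s)) {lo<..<hi} (nodoid_arc M \<eta>)"
proof -
  define b g where "b = sqrt M" and "g = nodoid_denominator M \<eta>"
  have f: "f > 0" "b > 0" "b\<^sup>2 = f\<^sup>2 - 1/4" using focal_properties[of M] M by (simp_all add: f_def b_def)
  have f_half: "1/2 < f" using focal_gt_half[OF M] by (simp add: f_def)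
  have \<eta>2: "\<eta> * \<eta> = 1" "\<eta>\<^sup>2 = 1" "\<bar>\<eta>\<bar> = 1" using \<eta> by auto
  note geo = nodoid_arc_geometry[OF M \<eta>, folded f_def b_def g_def]
  have gpos: "g u > 0" for u unfolding g_def by (rule hyperbola_roll(1)[OF M \<eta>])
  \<comment> \<open>\<open>D\<close> and \<open>b sin (2 s)\<close> are the legs and \<open>K\<close> the hypotenuse of the triangle
    that defines the hyperbolic parameter \<open>h\<close>.\<close>
  define D where "D = (\<lambda>s. f * cos (2 * s) - 1/2)"
  define K where "K = (\<lambda>s. f - cos (2 * s) / 2)"
  define h where "h = (\<lambda>s. arsinh (b * sin (2 * s) / D s))"
  have Kpos: "K s > 0" for s using f_half cos_le_one[of "2 * s"] unfolding K_def by linarith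
  have DK: "(D s)\<^sup>2 + (b * sin (2 * s))\<^sup>2 = (K s)\<^sup>2" for s
  proof -
    have "(D s)\<^sup>2 + (b * sin (2 * s))\<^sup>2 = (D s)\<^sup>2 + (f\<^sup>2 - 1/4) * (1 - (cos (2 * s))\<^sup>2)"
      by (simp add: power_mult_distrib f(3) sin_squared_eq)
    also have "\<dots> = (K s)\<^sup>2" unfolding D_def K_def by (simp add: field_simps power2_eq_square)
    finally show ?thesis .
  qed
  have D0: "\<eta> * D s > 0" "D s \<noteq> 0" if "s \<in> {lo<..<hi}" for s
  proof -
    show "\<eta> * D s > 0" unfolding D_def by (rule pos[OF that])
    then show "D s \<noteq> 0" by auto
  qed
  have absD: "\<bar>D s\<bar> = \<eta> * D s" if "s \<in> {lo<..<hi}" for s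
    using D0[OF that] \<eta>2 by (metis abs_mult abs_of_pos mult_1)
  have root: "sqrt ((b * sin (2 * s) / D s)\<^sup>2 + 1) = K s / (\<eta> * D s)" if s: "s \<in> {lo<..<hi}" for s
  proof -
    have "(b * sin (2 * s) / D s)\<^sup>2 + 1 = ((D s)\<^sup>2 + (b * sin (2 * s))\<^sup>2) / (D s)\<^sup>2"
      using D0[OF s] by (simp add: field_simps power_divide)
    then show ?thesis using Kpos[of s] by (simp add: DK real_sqrt_divide absD[OF s])
  qed
  have Dh: "(h has_real_derivative 2 * b * \<eta> / D s) (at s)" if s: "s \<in> {lo<..<hi}" for s
  proof -
    have "((\<lambda>s. b * sin (2 * s) / D s) has_real_derivative
        ((b * (cos (2 * s) * 2)) * D s - b * sin (2 * s) * (f * (- sin (2 * s) * 2) - 0)) / (D s * D s)) (at s)"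
      unfolding D_def
      by (rule derivative_eq_intros refl | use D0[OF s] in \<open>simp add: D_def\<close>)+
    moreover have "(b * (cos (2 * s) * 2)) * D s - b * sin (2 * s) * (f * (- sin (2 * s) * 2) - 0) = 2 * b * K s"
    proof -
      have "(b * (cos (2 * s) * 2)) * D s - b * sin (2 * s) * (f * (- sin (2 * s) * 2) - 0) =
          2 * b * (f * ((sin (2 * s))\<^sup>2 + (cos (2 * s))\<^sup>2) - cos (2 * s) / 2)"
        unfolding D_def by (simp add: algebra_simps power2_eq_square
            del: sin_cos_squared_add sin_cos_squared_add2 sin_cos_squared_add3)
      then show ?thesis by (simp add: K_def)
    qed
    ultimately have "((\<lambda>s. b * sin (2 * s) / D s) has_real_derivative 2 * b * K s / (D s * D s)) (at s)"
      by simp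
    then have "(h has_real_derivative 1 / (K s / (\<eta> * D s)) * (2 * b * K s / (D s * D s))) (at s)"
      unfolding h_def root[OF s, symmetric]
      by (rule DERIV_chain2[OF arsinh_real_has_field_derivative])
    moreover have "1 / (K s / (\<eta> * D s)) * (2 * b * K s / (D s * D s)) = 2 * b * \<eta> / D s"
      using Kpos[of s] D0[OF s] by (simp add: field_simps)
    ultimately show ?thesis by simp
  qed
  have h'pos: "2 * b * \<eta> / D s > 0" if s: "s \<in> {lo<..<hi}" for s
  proof -
    have "2 * b * \<eta> / D s = 2 * b * (\<eta> * D s) / (D s)\<^sup>2" using D0[OF s] by (simp add: power2_eq_square)
    then show ?thesis using D0[OF s] f by simp
  qed
  have gh: "g (h s) = \<eta> * b\<^sup>2 / D s" if s: "s \<in> {lo<..<hi}" for s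
  proof -
    have "cosh (h s) = K s / (\<eta> * D s)" using root[OF s] by (simp add: h_def cosh_arsinh_real)
    then have "g (h s) = f * (\<eta>\<^sup>2 * K s / (\<eta> * D s)) + \<eta> / 2"
      unfolding \<eta>2 by (simp add: g_def nodoid_denominator_def f_def)
    also have "\<dots> = \<eta> * (f * K s + D s / 2) / D s"
      using D0[OF s] by (simp add: field_simps power2_eq_square)
    also have "f * K s + D s / 2 = b\<^sup>2" unfolding f(3) D_def K_def by (simp add: field_simps power2_eq_square)
    finally show ?thesis .
  qed
  have im: "Im (nodoid_arc M \<eta> (h s)) = y s" if s: "s \<in> {lo<..<hi}" for s
  proof (rule power2_eq_imp_eq)
    have "(Im (nodoid_arc M \<eta> (h s)))\<^sup>2 = f\<^sup>2 + 1/4 - (1/2 + \<eta> * b\<^sup>2 / g (h s))"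
      unfolding geo(2) f(3) using f(1) by (simp add: field_simps power2_eq_square)
    also have "\<eta> * b\<^sup>2 / g (h s) = D s"
      unfolding gh[OF s] using f(2) D0[OF s] \<eta> by auto
    finally show "(Im (nodoid_arc M \<eta> (h s)))\<^sup>2 = (y s)\<^sup>2" by (simp add: y D_def)
  qed (use geo(3) y in \<open>auto intro: less_imp_le\<close>)
  have re: "((\<lambda>s. Re (nodoid_arc M \<eta> (h s))) has_real_derivative D s / y s) (at s)"
    if s: "s \<in> {lo<..<hi}" for s
  proof -
    obtain \<beta>' where \<beta>': "(nodoid_arc M \<eta> has_vector_derivative \<beta>') (at (h s))"
      "Re \<beta>' = \<eta> * b ^ 3 / (2 * Im (nodoid_arc M \<eta> (h s)) * (g (h s))\<^sup>2)"
      using geo(1) by blast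
    have "((\<lambda>u. Re (nodoid_arc M \<eta> u)) has_real_derivative Re \<beta>') (at (h s))"
      using \<beta>'(1) has_vector_derivative_complex_iff by blast
    from DERIV_chain2[OF this Dh[OF s]]
    have "((\<lambda>s. Re (nodoid_arc M \<eta> (h s))) has_real_derivative Re \<beta>' * (2 * b * \<eta> / D s)) (at s)" .
    moreover have "Re \<beta>' * (2 * b * \<eta> / D s) = D s / y s"
    proof -
      have "Re \<beta>' * (2 * b * \<eta> / D s) = (\<eta> * \<eta>) * b ^ 4 / (y s * (\<eta> * b\<^sup>2 / D s)\<^sup>2 * D s)"
        unfolding \<beta>'(2) im[OF s] gh[OF s] by (simp add: power3_eq_cube power4_eq_xxxx)
      also have "\<dots> = (\<eta> * \<eta>) * D s / (\<eta>\<^sup>2 * y s)"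
        using f(2) D0[OF s] y(1)[of s] by (simp add: field_simps power2_eq_square power4_eq_xxxx)
      finally show ?thesis by (simp add: \<eta>2)
    qed
    ultimately show ?thesis by simp
  qed
  define mid where "mid = (lo + hi) / 2"
  have mid: "mid \<in> {lo<..<hi}" using \<open>lo < hi\<close> by (simp add: mid_def)
  have const: "x s - Re (nodoid_arc M \<eta> (h s)) = x mid - Re (nodoid_arc M \<eta> (h mid))"
    if s: "s \<in> {lo<..<hi}" for s
  proof (rule DERIV_isconst3[OF \<open>lo < hi\<close> s mid])
    show "((\<lambda>s. x s - Re (nodoid_arc M \<eta> (h s))) has_real_derivative 0) (at t)"
      if "t \<in> {lo<..<hi}" for t
      using DERIV_diff[OF Dx re[OF that]] by (simp add: D_def)
  qed
  have surj: "u \<in> h ` {lo<..<hi}" for u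
  proof -
    define C S where "C = (1/2 + \<eta> * (f\<^sup>2 - 1/4) / g u) / f" and "S = \<eta> * b * (f * sinh u) / (f * g u)"
    have "C\<^sup>2 + S\<^sup>2 = 1" unfolding C_def S_def by (rule geo(6))
    then obtain E where E: "C = cos E" "S = sin E" using sincos_total_2pi by metis
    have DE: "f * cos E - 1/2 = \<eta> * b\<^sup>2 / g u"
      unfolding E(1)[symmetric] C_def f(3) using f(1) by simp
    have "\<eta> * (f * cos E - 1/2) = b\<^sup>2 / g u" unfolding DE using \<eta>2 by simp
    then have "\<eta> * (f * cos E - 1/2) > 0" using f(2) gpos[of u] by simp
    then obtain s where s: "s \<in> {lo<..<hi}" "cos (2 * s) = cos E" "sin (2 * s) = sin E"
      using onto by blast
    have "b * sin (2 * s) / D s = sinh u"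
      unfolding D_def s(2,3) DE unfolding E(2)[symmetric] S_def
      using f(1,2) gpos[of u] \<eta> by (auto simp: field_simps power2_eq_square)
    then have "h s = u" by (simp add: h_def arsinh_sinh_real)
    then show ?thesis using s(1) by blast
  qed
  show ?thesis
    unfolding runs_along_def
  proof (rule exI[of _ h], rule exI[of _ "x mid - Re (nodoid_arc M \<eta> (h mid))"], intro conjI ballI)
    show "\<exists>g'>0. (h has_real_derivative g') (at s)" if "s \<in> {lo<..<hi}" for s
      using Dh[OF that] h'pos[OF that] by blast
    show "h ` {lo<..<hi} = UNIV" using surj by blast
    show "Complex (x s) (y s) = nodoid_arc M \<eta> (h s) + of_real (x mid - Re (nodoid_arc M \<eta> (h mid)))"
      if "s \<in> {lo<..<hi}" for s
      using const[OF that] im[OF that] by (simp add: complex_eq_iff)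
  qed
qed

lemma runs_along_shift:
  assumes "runs_along \<delta> {lo<..<hi} \<beta>"
  shows "runs_along (\<lambda>s. \<delta> (s - a)) {lo + a<..<hi + a} \<beta>"
proof -
  obtain g d where g: "\<And>s. s \<in> {lo<..<hi} \<Longrightarrow> \<exists>g'>0. (g has_real_derivative g') (at s)"
    and "g ` {lo<..<hi} = UNIV" and \<delta>: "\<And>s. s \<in> {lo<..<hi} \<Longrightarrow> \<delta> s = \<beta> (g s) + of_real d"
    using assms unfolding runs_along_def by blast
  moreover have "(\<lambda>s. s - a) ` {lo + a<..<hi + a} = {lo<..<hi}"
    by (auto simp: image_iff intro!: bexI[of _ "_ + a"])
  ultimately have "(\<lambda>s. g (s - a)) ` {lo + a<..<hi + a} = UNIV" by (metis image_image)
  moreover have "\<exists>g'>0. ((\<lambda>s. g (s - a)) has_real_derivative g') (at s)" if "s \<in> {lo + a<..<hi + a}" for s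
  proof -
    have "s - a \<in> {lo<..<hi}" using that by auto
    then obtain g' where "g' > 0" "(g has_real_derivative g') (at (s - a))" using g by blast
    then show ?thesis using DERIV_shift[of g g' s "- a"] by auto
  qed
  ultimately show ?thesis
    unfolding runs_along_def using \<delta> by (intro exI[of _ "\<lambda>s. g (s - a)"] exI[of _ d]) auto
qed

text \<open>Modulo \<open>2 \<pi>\<close> the circle is cut at the angles \<open>\<plusminus> a\<close> into the arc around 0 and the arc around
  \<open>\<pi>\<close>; they will be the lower and the upper arc of the nodoid.\<close>
lemma angle_representatives:
  assumes a: "0 < a" "a < pi"
  shows "s \<in> {-a/2<..<a/2} \<Longrightarrow> cos a < cos (2 * s)"
    and "s \<in> {a/2<..<pi - a/2} \<Longrightarrow> cos (2 * s) < cos a"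
    and "cos a < cos E \<Longrightarrow> \<exists>s\<in>{-a/2<..<a/2}. cos (2 * s) = cos E \<and> sin (2 * s) = sin E"
    and "cos E < cos a \<Longrightarrow> \<exists>s\<in>{a/2<..<pi - a/2}. cos (2 * s) = cos E \<and> sin (2 * s) = sin E"
proof -
  have less: "cos q < cos p \<longleftrightarrow> p < q" if "0 \<le> p" "p \<le> pi" "0 \<le> q" "q \<le> pi" for p q
    using cos_mono_less_eq[of q p] that by simp
  show "cos a < cos (2 * s)" if "s \<in> {-a/2<..<a/2}"
  proof -
    have "\<bar>2 * s\<bar> < a" unfolding abs_less_iff using that by auto
    then have "cos a < cos \<bar>2 * s\<bar>" using cos_monotone_0_pi[of "\<bar>2 * s\<bar>" a] a by simp
    then show ?thesis by (simp only: cos_abs_real)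
  qed
  show "cos (2 * s) < cos a" if "s \<in> {a/2<..<pi - a/2}"
  proof (cases "2 * s \<le> pi")
    case True
    then show ?thesis using less[of a "2 * s"] that a by auto
  next
    case False
    then show ?thesis using less[of a "2 * pi - 2 * s"] that a by (auto simp: cos_diff)
  qed
  obtain t where t: "0 \<le> t" "t < 2 * pi" "cos E = cos t" "sin E = sin t"
    using sincos_total_2pi[of "cos E" "sin E"] by auto
  have t': "cos (2 * pi - t) = cos t" "cos (t - 2 * pi) = cos t" "sin (t - 2 * pi) = sin t"
    by (simp_all add: cos_diff sin_diff)
  show "\<exists>s\<in>{-a/2<..<a/2}. cos (2 * s) = cos E \<and> sin (2 * s) = sin E" if "cos a < cos E"
  proof (cases "t \<le> pi")
    case True
    then have "t < a" using less[of t a] t a that by simp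
    then show ?thesis using t a by (intro bexI[of _ "t / 2"]) auto
  next
    case False
    then have "2 * pi - t < a" using less[of "2 * pi - t" a] t t' a that by simp
    then show ?thesis using t t' a False by (intro bexI[of _ "t / 2 - pi"]) (auto simp: right_diff_distrib)
  qed
  show "\<exists>s\<in>{a/2<..<pi - a/2}. cos (2 * s) = cos E \<and> sin (2 * s) = sin E" if "cos E < cos a"
  proof (cases "t \<le> pi")
    case True
    then have "a < t" using less[of a t] t a that by simp
    then show ?thesis using t a True by (intro bexI[of _ "t / 2"]) auto
  next
    case False
    then have "a < 2 * pi - t" using less[of a "2 * pi - t"] t t' a that by simp
    then show ?thesis using t a False by (intro bexI[of _ "t / 2"]) auto
  qed
qed

text \<open>The profile is written down in arc length: the height is \<open>y = \<surd>(f\<^sup>2 + 1/4 - f cos (2 s))\<close>, and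
  unit speed determines the abscissa up to sign as a primitive of \<open>(f cos (2 s) - 1/2) / y\<close>.  The
  tangent is vertical where \<open>cos (2 s) = 1 / (2 f)\<close>; there the arcs meet.\<close>
lemma nodoid_exists:
  assumes M: "M > 0"
  shows "\<exists>\<delta>. nodoid_profile M \<delta>"
proof -
  define f where "f = focal M"
  have f: "f > 0" "f\<^sup>2 - 1/4 = M" "(f\<^sup>2 + 1/4) / f > 1"
    using focal_properties[of M] M by (simp_all add: f_def)
  have f_half: "1/2 < f" using focal_gt_half[OF M] by (simp add: f_def)
  define y where "y = (\<lambda>s. sqrt (f\<^sup>2 + 1/4 - f * cos (2 * s)))"
  have rad: "f\<^sup>2 + 1/4 - f * cos (2 * s) > 0" for s
  proof -
    have "f * cos (2 * s) \<le> f * 1" using f(1) by (intro mult_left_mono) auto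
    moreover have "f < f\<^sup>2 + 1/4" using f(1,3) by (simp add: field_simps)
    ultimately show ?thesis by linarith
  qed
  have y: "y s > 0" "(y s)\<^sup>2 = f\<^sup>2 + 1/4 - f * cos (2 * s)" for s
    using rad[of s] by (simp_all add: y_def)
  have smy: "smooth y"
    unfolding y_def by (intro smooth_sqrt smooth_intros rad)
  have "smooth (\<lambda>s. (f * cos (2 * s) - 1/2) / y s)"
    using y(1) by (intro smooth_divide smooth_intros smy) (simp add: order_less_imp_not_eq2)
  then obtain x where Dx: "\<And>s. (x has_real_derivative (f * cos (2 * s) - 1/2) / y s) (at s)" and smx: "smooth x"
    using smooth_imp_DERIV_ex by blast
  have Dy: "(y has_real_derivative f * sin (2 * s) / y s) (at s)" for s
    unfolding y_def
    by (rule derivative_eq_intros refl | use rad[of s] in \<open>simp add: field_simps\<close>)+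
  define a where "a = arccos (1 / (2 * f))"
  have a: "0 < a" "a < pi" "cos a = 1 / (2 * f)"
    unfolding a_def using f_half by (intro arccos_lt_bounded[THEN conjunct1] arccos_lt_bounded[THEN conjunct2] cos_arccos;
        simp add: field_simps)+
  have gt: "1 * (f * c - 1/2) > 0 \<longleftrightarrow> cos a < c" and lt: "-1 * (f * c - 1/2) > 0 \<longleftrightarrow> c < cos a" for c
    unfolding a(3) using f(1) by (auto simp: field_simps)
  note rep = angle_representatives[OF a(1,2)]
  let ?\<delta>0 = "\<lambda>s. Complex (x s) (y s)"
  \<comment> \<open>The lower arc is centred at 0 in \<open>?\<delta>0\<close>; the shift moves its beginning to 0.\<close>
  define \<delta> where "\<delta> = (\<lambda>s. ?\<delta>0 (s - a / 2))"
  have "runs_along ?\<delta>0 {-a/2<..<a/2} (nodoid_arc M 1)"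
  proof (rule runs_along_nodoid_arc[OF M disjI1[OF refl], folded f_def, OF y Dx])
    show "-a/2 < a/2" using a by simp
    show "1 * (f * cos (2 * s) - 1/2) > 0" if "s \<in> {-a/2<..<a/2}" for s
      unfolding gt by (rule rep(1)[OF that])
    show "\<exists>s\<in>{-a/2<..<a/2}. cos (2 * s) = cos E \<and> sin (2 * s) = sin E"
      if "1 * (f * cos E - 1/2) > 0" for E
      by (rule rep(3)[OF that[unfolded gt]])
  qed
  then have low: "runs_along \<delta> {0<..<a} (nodoid_lower_arc M)"
    using runs_along_shift[of ?\<delta>0 "-a/2" "a/2" _ "a/2"] by (simp add: \<delta>_def nodoid_arcs_eq[OF M])
  have "runs_along ?\<delta>0 {a/2<..<pi - a/2} (nodoid_arc M (-1))"
  proof (rule runs_along_nodoid_arc[OF M disjI2[OF refl], folded f_def, OF y Dx])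
    show "a/2 < pi - a/2" using a by simp
    show "-1 * (f * cos (2 * s) - 1/2) > 0" if "s \<in> {a/2<..<pi - a/2}" for s
      unfolding lt by (rule rep(2)[OF that])
    show "\<exists>s\<in>{a/2<..<pi - a/2}. cos (2 * s) = cos E \<and> sin (2 * s) = sin E"
      if "-1 * (f * cos E - 1/2) > 0" for E
      by (rule rep(4)[OF that[unfolded lt]])
  qed
  then have up: "runs_along \<delta> {a<..<a + (pi - a)} (nodoid_upper_arc M)"
    using runs_along_shift[of ?\<delta>0 "a/2" "pi - a/2" _ "a/2"] by (simp add: \<delta>_def nodoid_arcs_eq[OF M])
  have "smooth (\<lambda>s. x (s - a / 2) *\<^sub>R (1 :: complex) + y (s - a / 2) *\<^sub>R \<i>)"
    by (intro smooth_intros smooth_compose[OF smx] smooth_compose[OF smy])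
  moreover have "\<delta> = (\<lambda>s. x (s - a / 2) *\<^sub>R 1 + y (s - a / 2) *\<^sub>R \<i>)"
    by (simp add: \<delta>_def fun_eq_iff complex_eq_iff)
  ultimately have "smooth \<delta>" by simp
  moreover have "norm (vector_derivative \<delta> (at s)) = 1" for s
  proof -
    define r where "r = s - a / 2"
    have "(\<delta> has_vector_derivative Complex ((f * cos (2 * r) - 1/2) / y r) (f * sin (2 * r) / y r)) (at s)"
      unfolding \<delta>_def using DERIV_shift[of x _ s "- a / 2"] DERIV_shift[of y _ s "- a / 2"] Dx[of r] Dy[of r]
      by (intro has_vector_derivative_Complex) (simp_all add: r_def)
    moreover have "norm (Complex ((f * cos (2 * r) - 1/2) / y r) (f * sin (2 * r) / y r)) = 1"
    proof -
      have "(f * cos (2 * r) - 1/2)\<^sup>2 + (f * sin (2 * r))\<^sup>2 =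
          f\<^sup>2 * ((sin (2 * r))\<^sup>2 + (cos (2 * r))\<^sup>2) - f * cos (2 * r) + 1/4"
        by (simp add: power2_eq_square algebra_simps
            del: sin_cos_squared_add sin_cos_squared_add2 sin_cos_squared_add3)
      then have "(f * cos (2 * r) - 1/2)\<^sup>2 + (f * sin (2 * r))\<^sup>2 = (y r)\<^sup>2" by (simp add: y)
      then show ?thesis
        using y(1)[of r] by (simp add: complex_norm power_divide add_divide_distrib[symmetric])
    qed
    ultimately show ?thesis by (simp add: vector_derivative_at)
  qed
  moreover have "\<delta> (s + (a + (pi - a))) = \<delta> s + of_real (x pi - x 0)" for s
  proof -
    have yper: "y (s + pi) = y s" for s by (simp add: y_def distrib_left)
    have "((\<lambda>s. x (s + pi) - x s) has_real_derivative 0) (at s)" for s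
    proof -
      have "((\<lambda>s. x (s + pi)) has_real_derivative (f * cos (2 * (s + pi)) - 1/2) / y (s + pi)) (at s)"
        using Dx[of "s + pi"] by (simp only: DERIV_shift)
      from DERIV_diff[OF this Dx[of s]] show ?thesis by (simp add: yper distrib_left)
    qed
    then have "x (r + pi) - x r = x (0 + pi) - x 0" for r
      using DERIV_isconst_all[of "\<lambda>s. x (s + pi) - x s" r 0] by blast
    from this[of "s - a / 2"] have "x (s - a / 2 + pi) = x (s - a / 2) + (x pi - x 0)" by simp
    moreover have "s + (a + (pi - a)) - a / 2 = s - a / 2 + pi" by simp
    ultimately show ?thesis
      by (simp only: \<delta>_def yper complex_eq_iff complex.sel plus_complex.sel Re_complex_of_real
          Im_complex_of_real) simp
  qed
  ultimately show ?thesis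
    unfolding nodoid_profile_def using low up a(1,2)
    by (intro exI[of _ \<delta>] conjI allI exI[of _ a] exI[of _ "pi - a"] exI[of _ "x pi - x 0"]) auto
qed

section \<open>Special Twizzlers and Delaunay surfaces\<close>

lemma delaunay_pulls_back_model:
  assumes "delaunay M D"
  shows "pulls_back_model (((focal M)\<^sup>2 + 1/4) / focal M) D"
  using assms unfolding delaunay_def by (elim conjE disjE exE; hypsubst)
    (rule unduloid_pulls_back_model nodoid_pulls_back_model; assumption)+

lemma delaunay_exists:
  assumes "- 1/4 < M" "M \<noteq> 0"
  shows "\<exists>D. delaunay M D"
  using assms nodoid_exists[of M] unfolding delaunay_def by (cases "M < 0") (blast, fastforce)

lemma focal_ratio:
  assumes cd: "0 < c" "0 < d" and M: "1/4 + M = (d / (2 * c))\<^sup>2"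
  shows "((focal M)\<^sup>2 + 1/4) / focal M = (c\<^sup>2 + d\<^sup>2) / (2 * c * d)"
proof -
  have "focal M = d / (2 * c)" unfolding focal_def M using cd by simp
  then have "((focal M)\<^sup>2 + 1/4) / focal M = ((d / (2 * c))\<^sup>2 + 1/4) / (d / (2 * c))" by simp
  also have "\<dots> = (c\<^sup>2 + d\<^sup>2) / (2 * c * d)" using cd by (simp add: field_simps power2_eq_square)
  finally show ?thesis .
qed

theorem theorem1p11:
  fixes v :: real and S :: "real \<times> real \<Rightarrow> real ^ 3"
  assumes "0 < v" and "v < 1"
    and "special_twizzler v S"
  shows "(\<exists>p q. (\<forall>r. gauss_curvature S r \<le> gauss_curvature S p) \<and>
                (\<forall>r. gauss_curvature S q \<le> gauss_curvature S r) \<and>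
                gauss_curvature S p / gauss_curvature S q = - v)
       \<and> (\<exists>D. delaunay (- sqrt v / (1 + sqrt v)\<^sup>2) D)
       \<and> (\<forall>D. delaunay (- sqrt v / (1 + sqrt v)\<^sup>2) D \<longrightarrow> isometric_planes S D)
       \<and> (\<exists>D. delaunay (sqrt v / (1 - sqrt v)\<^sup>2) D)
       \<and> (\<forall>D. delaunay (sqrt v / (1 - sqrt v)\<^sup>2) D \<longrightarrow> isometric_planes S D)"
proof -
  define r where "r = sqrt v"
  have r: "0 < r" "r < 1" "v = r\<^sup>2" using assms(1,2) by (simp_all add: r_def)
  define M N where "M = - sqrt v / (1 + sqrt v)\<^sup>2" and "N = sqrt v / (1 - sqrt v)\<^sup>2"
  have M: "1/4 + M = ((1 - r) / (2 * (1 + r)))\<^sup>2" "M \<noteq> 0"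
    and N: "1/4 + N = ((1 + r) / (2 * (1 - r)))\<^sup>2" "N \<noteq> 0"
  proof -
    have nz: "1 + r \<noteq> 0" "1 - r \<noteq> 0" using r by auto
    have "1/4 + - r / A\<^sup>2 = (A\<^sup>2 - 4 * r) / (2 * A)\<^sup>2" "1/4 + r / A\<^sup>2 = (A\<^sup>2 + 4 * r) / (2 * A)\<^sup>2"
      if "A \<noteq> 0" for A using that by (simp_all add: field_simps)
    note this[OF nz(1)] this[OF nz(2)]
    then show "1/4 + M = ((1 - r) / (2 * (1 + r)))\<^sup>2" "1/4 + N = ((1 + r) / (2 * (1 - r)))\<^sup>2"
      unfolding M_def N_def r_def[symmetric] power_divide by (simp_all add: power2_eq_square algebra_simps)
    show "M \<noteq> 0" "N \<noteq> 0" using nz r by (simp_all add: M_def N_def r_def[symmetric])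
  qed
  have pos: "- 1/4 < M" "- 1/4 < N"
  proof -
    have "0 < 1/4 + M" "0 < 1/4 + N" unfolding M N using r by simp_all
    then show "- 1/4 < M" "- 1/4 < N" by simp_all
  qed
  have S: "pulls_back_model ((1 + v) / (1 - v)) S"
    by (rule special_twizzler_pulls_back_model[OF assms])
  have "(1 + r\<^sup>2) / (1 - r\<^sup>2) = ((1 + r)\<^sup>2 + (1 - r)\<^sup>2) / (2 * (1 + r) * (1 - r))"
  proof -
    have num: "(1 + r)\<^sup>2 + (1 - r)\<^sup>2 = 2 * (1 + r\<^sup>2)" and den: "2 * (1 + r) * (1 - r) = 2 * (1 - r\<^sup>2)"
      by (simp_all add: power2_eq_square algebra_simps)
    show ?thesis unfolding num den by (rule mult_divide_mult_cancel_left[symmetric]) simp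
  qed
  moreover from this have "(1 + r\<^sup>2) / (1 - r\<^sup>2) = ((1 - r)\<^sup>2 + (1 + r)\<^sup>2) / (2 * (1 - r) * (1 + r))"
    by (simp only: ac_simps)
  ultimately have "((focal M)\<^sup>2 + 1/4) / focal M = (1 + v) / (1 - v)" "((focal N)\<^sup>2 + 1/4) / focal N = (1 + v) / (1 - v)"
    using focal_ratio[OF _ _ M(1)] focal_ratio[OF _ _ N(1)] r by simp_all
  then have iso: "isometric_planes S D" if "delaunay M D \<or> delaunay N D" for D
    using that delaunay_pulls_back_model isometric_of_pulls_back_model[OF S] by metis
  show ?thesis
    unfolding M_def[symmetric] N_def[symmetric]
    using special_twizzler_gauss_curvature_ratio[OF assms] iso delaunay_exists[OF pos(1) M(2)]
      delaunay_exists[OF pos(2) N(2)] by blast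
qed

end
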